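(* Let $n\ge4$ be even and let $F$ be a field of characteristic $\neq2$. For any non-simple $(n+1)$-dimensional $n$-Lie algebra $L$ over $F$, the natural map $i\colon L\to U(L)$ from $L$ to its universal associative envelope is injective.
   Context: An $n$-Lie algebra is a vector space over a field of characteristic $\neq2$ with a multilinear alternating operation $[z_1,\dots,z_n]$ (permuting arguments by $\sigma$ multiplies by the sign $\epsilon(\sigma)$) satisfying $[[z_1,\dots,z_n],w_2,\dots,w_n]=\sum_{i=1}^n[z_1,\dots,[z_i,w_2,\dots,w_n],\dots,z_n]$. It is simple if its bracket is nonzero and it has no ideals (subspaces $J$ with $[J,L,\dots,L]\subseteq J$) other than $0$ and $L$. Universal associative envelope: a unital associative algebra $U(L)$ with a linear map $i\colon L\to U(L)$ satisfying $i([z_1,\dots,z_n])=\mathrm{alt}(i(z_1),\dots,i(z_n))$, where $\mathrm{alt}(z_1,\dots,z_n)=\sum_{\sigma\in S_n}\epsilon(\sigma)z_{\sigma(1)}\cdots z_{\sigma(n)}$, such that for any unital associative algebra $A$ and linear map $j\colon L\to A$ satisfying the same equation there is a unique unital algebra homomorphism $\psi\colon U(L)\to A$ with $\psi\circ i=j$. Concretely, for a basis $e_1,\dots,e_{n+1}$ of $L$ and the linear map $\phi\colon L\to F\langle x_1,\dots,x_{n+1}\rangle$ (free unital associative algebra) with $\phi(e_k)=x_k$, $U(L)=F\langle x_1,\dots,x_{n+1}\rangle/I$, where $I$ is the two-sided ideal generated by $(-1)^{\lfloor n/2\rfloor}\big(\mathrm{alt}(x_1,\dots,\widehat{x}_k,\dots,x_{n+1})-\phi([e_1,\dots,\widehat{e}_k,\dots,e_{n+1}])\big)$,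 $1\le k\le n+1$ (a hat means omission), and $i(e_k)=x_k+I$. *)

theory Defs
  imports
    Complex_Main
    "HOL-Library.Poly_Mapping"
    "HOL-Combinatorics.Permutations"
    "HOL-Computational_Algebra.Primes"
    "HOL-Algebra.QuotRing"
begin

text \<open>
  The carrier of \<open>L\<close> is a whole type; the bracket is an operation on lists of which only the
  values on lists of length \<open>n\<close> matter. Positions are counted from 0.
\<close>

locale n_lie_algebra = vector_space scale
  for scale :: "'f::field \<Rightarrow> 'v::ab_group_add \<Rightarrow> 'v" +
  fixes n :: nat and bracket :: "'v list \<Rightarrow> 'v"
  assumes char_neq_2: "CHAR('f) \<noteq> 2"
    and multilinear: "\<And>zs i. length zs = n \<Longrightarrow> i < n \<Longrightarrow>
          Vector_Spaces.linear scale scale (\<lambda>z. bracket (zs[i := z]))"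
    and alternating: "\<And>zs \<sigma>. length zs = n \<Longrightarrow> \<sigma> permutes {..<n} \<Longrightarrow>
          bracket (permute_list \<sigma> zs) = scale (of_int (sign \<sigma>)) (bracket zs)"
    and derivation: "\<And>zs ws. length zs = n \<Longrightarrow> length ws = n - 1 \<Longrightarrow>
          bracket (bracket zs # ws) = (\<Sum>i<n. bracket (zs[i := bracket (zs ! i # ws)]))"
begin

definition lie_ideal :: "'v set \<Rightarrow> bool" where
  "lie_ideal J \<longleftrightarrow> subspace J \<and> (\<forall>x\<in>J. \<forall>ws. length ws = n - 1 \<longrightarrow> bracket (x # ws) \<in> J)"

definition simple :: bool where
  "simple \<longleftrightarrow> (\<exists>zs. length zs = n \<and> bracket zs \<noteq> 0) \<and>
     (\<forall>J. lie_ideal J \<longrightarrow> J = {0} \<or> J = UNIV)"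

definition ordered_basis :: "'v list \<Rightarrow> bool" where
  "ordered_basis es \<longleftrightarrow> distinct es \<and> independent (set es) \<and> span (set es) = UNIV"

end

text \<open>
  Words are wrapped lists, so that concatenation can serve as the addition of the exponent monoid
  of \<open>poly_mapping\<close>: convolution on \<open>'a word \<Rightarrow>\<^sub>0 'f\<close> is then the product of noncommutative
  polynomials.
\<close>

datatype 'a word = Word (letters: "'a list")

instantiation word :: (type) monoid_add
begin

definition zero_word :: "'a word" where "0 = Word []"

definition plus_word :: "'a word \<Rightarrow> 'a word \<Rightarrow> 'a word" where
  "u + v = Word (letters u @ letters v)"

instance
  by standard (simp_all add: zero_word_def plus_word_def)

end

text \<open>The free unital associative algebra on the \<open>m\<close> generators \<open>var k\<close>, \<open>k < m\<close>.\<close>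

definition free_algebra :: "nat \<Rightarrow> (nat word \<Rightarrow>\<^sub>0 'f::field) ring" where
  "free_algebra m =
     \<lparr>carrier = {p. \<forall>w\<in>Poly_Mapping.keys p. set (letters w) \<subseteq> {..<m}},
      mult = (*), one = 1, zero = 0, add = (+)\<rparr>"

definition var :: "nat \<Rightarrow> (nat word \<Rightarrow>\<^sub>0 'f::field)" where
  "var k = Poly_Mapping.single (Word [k]) 1"

definition const :: "'f::field \<Rightarrow> (nat word \<Rightarrow>\<^sub>0 'f)" where
  "const c = Poly_Mapping.single 0 c"

definition alt :: "'a::ring_1 list \<Rightarrow> 'a" where
  "alt zs = (\<Sum>\<sigma> | \<sigma> permutes {..<length zs}. of_int (sign \<sigma>) * prod_list (permute_list \<sigma> zs))"

definition omit :: "nat \<Rightarrow> 'a list \<Rightarrow> 'a list" where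
  "omit k xs = take k xs @ drop (Suc k) xs"

text \<open>
  The envelope is built from a basis \<open>es\<close>, here \<open>e\<^sub>1, \<dots>, e\<^sub>n\<^sub>+\<^sub>1\<close> as \<open>es ! 0, \<dots>, es ! n\<close>. Note that
  \<open>Idl\<close> and \<open>Quot\<close> are two-sided in \<open>HOL-Algebra\<close> and that every ideal of the ring
  \<open>free_algebra m\<close> is a linear subspace, since scalars lie in the ring as \<open>const c\<close>.
\<close>

context n_lie_algebra
begin

definition phi :: "'v list \<Rightarrow> 'v \<Rightarrow> (nat word \<Rightarrow>\<^sub>0 'f)" where
  "phi es v = (\<Sum>k<length es. const (representation (set es) v (es ! k)) * var k)"

definition env_relation :: "'v list \<Rightarrow> nat \<Rightarrow> (nat word \<Rightarrow>\<^sub>0 'f)" where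
  "env_relation es k =
     (-1) ^ (n div 2) * (alt (omit k (map var [0..<n + 1])) - phi es (bracket (omit k es)))"

definition env_ideal :: "'v list \<Rightarrow> (nat word \<Rightarrow>\<^sub>0 'f) set" where
  "env_ideal es = Idl\<^bsub>free_algebra (n + 1)\<^esub> (env_relation es ` {..n})"

definition envelope :: "'v list \<Rightarrow> (nat word \<Rightarrow>\<^sub>0 'f) set ring" where
  "envelope es = free_algebra (n + 1) Quot env_ideal es"

definition env_map :: "'v list \<Rightarrow> 'v \<Rightarrow> (nat word \<Rightarrow>\<^sub>0 'f) set" where
  "env_map es v = env_ideal es +>\<^bsub>free_algebra (n + 1)\<^esub> phi es v"

end

lemma ring_free_algebra: "ring (free_algebra m :: (nat word \<Rightarrow>\<^sub>0 'f::field) ring)"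
proof -
  have plus: "p + q \<in> carrier (free_algebra m)"
    if "p \<in> carrier (free_algebra m)" "q \<in> carrier (free_algebra m)"
    for p q :: "nat word \<Rightarrow>\<^sub>0 'f"
    using that Poly_Mapping.keys_add[of p q] unfolding free_algebra_def by simp blast
  have times: "p * q \<in> carrier (free_algebra m)"
    if p: "p \<in> carrier (free_algebra m)" and q: "q \<in> carrier (free_algebra m)"
    for p q :: "nat word \<Rightarrow>\<^sub>0 'f"
  proof -
    have "set (letters w) \<subseteq> {..<m}" if w: "w \<in> Poly_Mapping.keys (p * q)" for w
    proof -
      obtain u v where "u \<in> Poly_Mapping.keys p" "v \<in> Poly_Mapping.keys q" "w = u + v"
        using w Poly_Mapping.keys_mult[of p q] by blast
      then show ?thesis using p q unfolding free_algebra_def plus_word_def by simp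
    qed
    then show ?thesis unfolding free_algebra_def by simp
  qed
  have uminus: "- p \<in> carrier (free_algebra m)" if "p \<in> carrier (free_algebra m)"
    for p :: "nat word \<Rightarrow>\<^sub>0 'f"
    using that unfolding free_algebra_def by simp
  have one: "(1 :: nat word \<Rightarrow>\<^sub>0 'f) \<in> carrier (free_algebra m)"
    unfolding free_algebra_def by (simp add: zero_word_def)
  have zero: "(0 :: nat word \<Rightarrow>\<^sub>0 'f) \<in> carrier (free_algebra m)"
    unfolding free_algebra_def by simp
  have ops: "p \<oplus>\<^bsub>free_algebra m\<^esub> q = p + q" "p \<otimes>\<^bsub>free_algebra m\<^esub> q = p * q"
    "\<one>\<^bsub>free_algebra m\<^esub> = (1 :: nat word \<Rightarrow>\<^sub>0 'f)" "\<zero>\<^bsub>free_algebra m\<^esub> = (0 :: nat word \<Rightarrow>\<^sub>0 'f)"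
    for p q :: "nat word \<Rightarrow>\<^sub>0 'f"
    unfolding free_algebra_def by simp_all
  show ?thesis
  proof (rule ringI)
    show "abelian_group (free_algebra m :: (nat word \<Rightarrow>\<^sub>0 'f) ring)"
    proof (rule abelian_groupI)
      fix p :: "nat word \<Rightarrow>\<^sub>0 'f"
      assume "p \<in> carrier (free_algebra m)"
      then show "\<exists>q\<in>carrier (free_algebra m). q \<oplus>\<^bsub>free_algebra m\<^esub> p = \<zero>\<^bsub>free_algebra m\<^esub>"
        by (intro bexI[of _ "- p"]) (simp_all add: ops uminus)
    qed (simp_all add: ops plus zero add.assoc add.commute)
    show "Group.monoid (free_algebra m :: (nat word \<Rightarrow>\<^sub>0 'f) ring)"
      by (rule monoidI) (simp_all add: ops times one mult.assoc)
  qed (simp_all add: ops distrib_left distrib_right)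
qed

context n_lie_algebra
begin

lemma phi_in_free_algebra: "phi es v \<in> carrier (free_algebra (length es))"
proof -
  interpret R: ring "free_algebra (length es) :: (nat word \<Rightarrow>\<^sub>0 'f) ring"
    by (rule ring_free_algebra)
  have "(\<Sum>k\<in>A. const (c k) * var k) \<in> carrier (free_algebra (length es))"
    if "finite A" "A \<subseteq> {..<length es}" for A and c :: "nat \<Rightarrow> 'f"
    using that
  proof (induction A rule: finite_induct)
    case empty
    show ?case unfolding free_algebra_def by simp
  next
    case (insert k A)
    have "const (c k) * var k \<in> carrier (free_algebra (length es) :: (nat word \<Rightarrow>\<^sub>0 'f) ring)"
      using insert.prems
      unfolding const_def var_def free_algebra_def by (simp add: mult_single)
    then have "(const (c k) * var k) \<oplus>\<^bsub>free_algebra (length es)\<^esub> (\<Sum>k\<in>A. const (c k) * var k)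
        \<in> carrier (free_algebra (length es))"
      using insert by (intro R.a_closed) auto
    then show ?case using insert.hyps unfolding free_algebra_def by simp
  qed
  from this[of "{..<length es}"] show ?thesis unfolding phi_def by simp
qed

lemma env_map_in_envelope:
  assumes "length es = n + 1"
  shows "env_map es v \<in> carrier (envelope es)"
  using phi_in_free_algebra[of es v] assms
  unfolding env_map_def envelope_def FactRing_def A_RCOSETS_def' by auto

end

end

theory Submission
  imports Defs "Jordan_Normal_Form.Determinant"
begin

text \<open>
  Let \<open>b\<^sub>k\<close> be the bracket of all basis vectors but the \<open>k\<close>-th, and let \<open>\<beta> k j\<close> be the \<open>j\<close>-th
  coordinate of \<open>(-1)\<^sup>k b\<^sub>k\<close>. The square matrix \<open>\<beta>\<close> determines the \<open>n\<close>-Lie algebra. The natural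
  map is injective as soon as some linear function from the free algebra to \<open>L\<close> vanishes on the
  ideal of relations and sends every generator to its basis vector (\<open>inj_env_map_criterion\<close>). How
  such a function is found depends on whether \<open>\<beta>\<close> is symmetric.

  If \<open>\<beta>\<close> is symmetric, the diamond lemma applies. Order the words so that the leading word of the
  \<open>k\<close>-th relation is the increasing word that omits the letter \<open>k\<close>. Two leading words that
  properly overlap join to an increasing word in \<open>n + 1\<close> letters, which must be the full
  increasing word, so there is a single ambiguity. For even \<open>n\<close>, expanding the alternating sum of
  all \<open>n + 1\<close> generators along its first and along its last factor gives \<open>\<Sum>k. (-1)\<^sup>k [x\<^sub>k,
  D\<^sub>k] = 0\<close>, where \<open>D\<^sub>k\<close> is the alternating sum that omits \<open>x\<^sub>k\<close>; and \<open>\<Sum>k. (-1)\<^sup>k [x\<^sub>k, b\<^sub>k]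
  = \<Sum>k. \<Sum>j. \<beta> k j [x\<^sub>k, x\<^sub>j]\<close> vanishes by symmetry. Hence the same identity holds
  between the relations themselves (\<open>commutator_relation\<close>), and it resolves the ambiguity. The
  function is then defined by well-founded recursion (\<open>triangular_functional\<close>), with arbitrary
  values on words without a leading word inside; the generators are such words.

  If \<open>\<beta>\<close> is not symmetric, let \<open>A i j = \<beta> i j - \<beta> j i\<close>. The derivation identity makes the cyclic
  sum of \<open>A i j \<beta> k\<close> over \<open>i\<close>, \<open>j\<close>, \<open>k\<close> vanish, with \<open>\<beta> k\<close> regarded as a vector
  (\<open>signed_bracket_cyclic\<close>). With one nonzero entry \<open>A p q\<close> this forces all brackets into a plane
  \<open>P\<close>, and makes a bracket with two arguments in \<open>P\<close> vanish: up to a choice of basis, the algebra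
  is given by one operator \<open>T\<close> on \<open>P\<close> and \<open>n - 1\<close> linear forms that vanish on \<open>P\<close>
  (\<open>nonsymmetric_structure\<close>). Now a function can be written down: it reads a word from the right,
  turns the last letter into a vector, evaluates the linear forms cyclically on the letters before
  it, and applies \<open>T\<close> after each full cycle of \<open>n - 1\<close> letters. A block of \<open>n\<close> consecutive letters
  away from the end of the word meets the same linear form twice, so that alternating over it
  gives zero; a block at the end reproduces the bracket (\<open>inj_env_map_if_nonsymmetric\<close>).
\<close>

section \<open>Permuted lists and alternating sums\<close>

lemma omit_nth:
  assumes "k < length xs" "i < length xs - 1"
  shows "omit k xs ! i = xs ! (if i < k then i else Suc i)"
  using assms unfolding omit_def by (auto simp: nth_append min_def)

lemma length_omit: "k < length xs \<Longrightarrow> length (omit k xs) = length xs - 1"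
  unfolding omit_def by auto

lemma map_omit: "map f (omit k xs) = omit k (map f xs)"
  unfolding omit_def by (simp add: take_map drop_map)

lemma set_omit_upt: "set (omit k [0..<m]) = {..<m} - {k}"
  by (cases "k < m") (auto simp: omit_def take_upt drop_upt)

lemma permute_list_insert_first:
  assumes "length xs = Suc n" "k \<le> n" "q permutes {..<n}"
  shows "permute_list (permutation_insert 0 k q) xs = xs ! k # permute_list q (omit k xs)"
proof (rule nth_equalityI)
  fix i assume "i < length (permute_list (permutation_insert 0 k q) xs)"
  then have i: "i < Suc n" using assms by simp
  show "permute_list (permutation_insert 0 k q) xs ! i = (xs ! k # permute_list q (omit k xs)) ! i"
  proof (cases i)
    case 0
    then show ?thesis using assms by (simp add: permute_list_def permutation_insert_expand del: upt_Suc)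
  next
    case (Suc j)
    then have j: "j < n" "q j < n" using i permutes_in_image[OF assms(3), of j] by auto
    then show ?thesis using assms Suc
      by (simp add: permute_list_def permutation_insert_expand omit_nth length_omit del: upt_Suc)
  qed
qed (use assms in \<open>simp add: length_omit\<close>)

lemma permute_list_insert_last:
  assumes "length xs = Suc n" "k \<le> n" "q permutes {..<n}"
  shows "permute_list (permutation_insert n k q) xs = permute_list q (omit k xs) @ [xs ! k]"
proof (rule nth_equalityI)
  fix i assume "i < length (permute_list (permutation_insert n k q) xs)"
  then have i: "i < Suc n" using assms by simp
  show "permute_list (permutation_insert n k q) xs ! i = (permute_list q (omit k xs) @ [xs ! k]) ! i"
  proof (cases "i = n")
    case True
    then show ?thesis using assms
      by (simp add: permute_list_def permutation_insert_expand nth_append length_omit del: upt_Suc)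
  next
    case False
    then have j: "i < n" "q i < n" using i permutes_in_image[OF assms(3), of i] by auto
    then show ?thesis using assms
      by (simp add: permute_list_def permutation_insert_expand omit_nth length_omit nth_append del: upt_Suc)
  qed
qed (use assms in \<open>simp add: length_omit\<close>)

lemma sum_permutes_Suc:
  fixes f :: "(nat \<Rightarrow> nat) \<Rightarrow> 'a::ab_group_add"
  assumes "i \<le> n"
  shows "(\<Sum>\<sigma> | \<sigma> permutes {..<Suc n}. f \<sigma>) =
         (\<Sum>k\<le>n. \<Sum>q | q permutes {..<n}. f (permutation_insert i k q))"
proof -
  let ?P = "{\<sigma>. \<sigma> permutes {..<Suc n}}"
  have fin: "finite ?P" by (simp add: finite_permutations)
  have img: "\<sigma> i \<in> {..n}" if "\<sigma> \<in> ?P" for \<sigma>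
    using that assms permutes_in_image[of \<sigma> "{..<Suc n}" i] by auto
  have "(\<Sum>\<sigma>\<in>?P. f \<sigma>) = (\<Sum>k\<le>n. \<Sum>\<sigma>\<in>{\<sigma>\<in>?P. \<sigma> i = k}. f \<sigma>)"
    by (rule sum.group[symmetric, OF fin]) (use img in auto)
  also have "\<dots> = (\<Sum>k\<le>n. \<Sum>q | q permutes {..<n}. f (permutation_insert i k q))"
  proof (rule sum.cong[OF refl])
    fix k assume "k \<in> {..n}"
    then have k: "k < Suc n" and i: "i < Suc n" using assms by auto
    have "{\<sigma>\<in>?P. \<sigma> i = k} = permutation_insert i k ` {q. q permutes {..<n}}"
      using permutation_fix[OF i k] by (simp add: atLeast0LessThan)
    then show "(\<Sum>\<sigma>\<in>{\<sigma>\<in>?P. \<sigma> i = k}. f \<sigma>) = (\<Sum>q | q permutes {..<n}. f (permutation_insert i k q))"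
      using permutation_insert_inj_on[OF i k]
      by (simp add: sum.reindex atLeast0LessThan)
  qed
  finally show ?thesis .
qed

text \<open>
  Permutations are sorted by the index that they move to the front (below: to the back). Moving the
  \<open>k\<close>-th entry past its \<open>k\<close> predecessors, or its \<open>n - k\<close> successors, accounts for the sign.
\<close>
lemma alt_expand_first:
  fixes xs :: "'a::ring_1 list"
  assumes "length xs = Suc n"
  shows "alt xs = (\<Sum>k\<le>n. (-1) ^ k * (xs ! k * alt (omit k xs)))"
proof -
  have "alt xs = (\<Sum>k\<le>n. \<Sum>q | q permutes {..<n}.
      (-1) ^ k * (xs ! k * (of_int (sign q) * prod_list (permute_list q (omit k xs)))))"
    unfolding alt_def assms
    unfolding sum_permutes_Suc[OF le0]
  proof (intro sum.cong refl)
    fix k q assume "k \<in> {..n}" "q \<in> {q. q permutes {..<n}}"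
    then have k: "k \<le> n" and q: "q permutes {..<n}" by auto
    have s: "of_int (sign (permutation_insert 0 k q)) = (-1) ^ k * (of_int (sign q) :: 'a)"
      using signof_permutation_insert[of q n 0 k, where 'a = 'a] k q by (simp add: atLeast0LessThan)
    show "of_int (sign (permutation_insert 0 k q)) * prod_list (permute_list (permutation_insert 0 k q) xs)
      = (-1) ^ k * (xs ! k * (of_int (sign q) * prod_list (permute_list q (omit k xs))))"
      unfolding s permute_list_insert_first[OF assms k q] by (simp add: sign_def)
  qed
  also have "\<dots> = (\<Sum>k\<le>n. (-1) ^ k * (xs ! k * alt (omit k xs)))"
    using assms by (intro sum.cong refl) (simp add: alt_def length_omit sum_distrib_left)
  finally show ?thesis .
qed

lemma alt_expand_last:
  fixes xs :: "'a::ring_1 list"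
  assumes "length xs = Suc n"
  shows "alt xs = (\<Sum>k\<le>n. (-1) ^ (n + k) * (alt (omit k xs) * xs ! k))"
proof -
  have "alt xs = (\<Sum>k\<le>n. \<Sum>q | q permutes {..<n}.
      (-1) ^ (n + k) * (of_int (sign q) * prod_list (permute_list q (omit k xs)) * xs ! k))"
    unfolding alt_def assms
    unfolding sum_permutes_Suc[OF order_refl]
  proof (intro sum.cong refl)
    fix k q assume "k \<in> {..n}" "q \<in> {q. q permutes {..<n}}"
    then have k: "k \<le> n" and q: "q permutes {..<n}" by auto
    have s: "of_int (sign (permutation_insert n k q)) = (-1) ^ (n + k) * (of_int (sign q) :: 'a)"
      using signof_permutation_insert[of q n n k, where 'a = 'a] k q by (simp add: atLeast0LessThan)
    show "of_int (sign (permutation_insert n k q)) * prod_list (permute_list (permutation_insert n k q) xs)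
      = (-1) ^ (n + k) * (of_int (sign q) * prod_list (permute_list q (omit k xs)) * xs ! k)"
      unfolding s permute_list_insert_last[OF assms k q] by (simp add: mult.assoc)
  qed
  also have "\<dots> = (\<Sum>k\<le>n. (-1) ^ (n + k) * (alt (omit k xs) * xs ! k))"
    using assms by (intro sum.cong refl) (simp add: alt_def length_omit sum_distrib_left sum_distrib_right)
  finally show ?thesis .
qed

lemma permute_list_transpose:
  "permute_list (transpose (length X) (Suc (length X + length Y))) (X @ a # Y @ b # Z) = X @ b # Y @ a # Z"
proof (rule nth_equalityI)
  let ?i = "length X" and ?j = "Suc (length X + length Y)"
  let ?L = "X @ a # Y @ b # Z" and ?M = "X @ b # Y @ a # Z"
  fix m assume "m < length (permute_list (transpose ?i ?j) ?L)"
  then have m: "m < length ?L" by simp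
  have *: "?L ! ?i = a" "?M ! ?i = b" "?L ! ?j = b" "?M ! ?j = a"
    by (simp_all add: nth_append)
  have eq: "?M ! m = ?L ! m" if "m \<noteq> ?i" "m \<noteq> ?j"
    using that by (auto simp: nth_append nth_Cons split: nat.splits)
  show "permute_list (transpose ?i ?j) ?L ! m = ?M ! m"
  proof -
    have "permute_list (transpose ?i ?j) ?L ! m = ?L ! transpose ?i ?j m"
      using m by (intro permute_list_nth permutes_swap_id) auto
    also have "\<dots> = ?M ! m"
      using * eq by (cases "m = ?i"; cases "m = ?j") (simp_all add: transpose_def)
    finally show ?thesis .
  qed
qed simp

lemma split_list_two_positions:
  assumes "j < k" "k < length xs"
  obtains X Y Z where "xs = X @ xs ! j # Y @ xs ! k # Z" "length X = j" "length Y = k - Suc j"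
proof
  have "drop (Suc j) xs = take (k - Suc j) (drop (Suc j) xs) @ xs ! k # drop (Suc k) xs"
    using assms id_take_nth_drop[of "k - Suc j" "drop (Suc j) xs"] by simp
  then show "xs = take j xs @ xs ! j # take (k - Suc j) (drop (Suc j) xs) @ xs ! k # drop (Suc k) xs"
    using assms id_take_nth_drop[of j xs] by simp
qed (use assms in auto)

lemma omit_append: "length X = k \<Longrightarrow> omit k (X @ a # W) = X @ W"
  unfolding omit_def by simp

lemma permute_list_inj:
  assumes "distinct xs" "\<sigma> permutes {..<length xs}" "\<tau> permutes {..<length xs}"
    and eq: "permute_list \<sigma> xs = permute_list \<tau> xs"
  shows "\<sigma> = \<tau>"
proof
  fix i
  show "\<sigma> i = \<tau> i"
  proof (cases "i < length xs")
    case True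
    then have "xs ! \<sigma> i = xs ! \<tau> i"
      using permute_list_nth[OF assms(2) True] permute_list_nth[OF assms(3) True] eq by simp
    moreover have "\<sigma> i < length xs" "\<tau> i < length xs"
      using permutes_in_image[OF assms(2), of i] permutes_in_image[OF assms(3), of i] True by simp_all
    ultimately show ?thesis using assms(1) by (simp add: nth_eq_iff_index_eq)
  next
    case False
    then show ?thesis using permutes_not_in[OF assms(2), of i] permutes_not_in[OF assms(3), of i] by simp
  qed
qed

section \<open>Linear functions on the free algebra\<close>

abbreviation monomial :: "nat list \<Rightarrow> (nat word \<Rightarrow>\<^sub>0 'f::field)" where
  "monomial w \<equiv> Poly_Mapping.single (Word w) 1"

lemma monomial_mult: "monomial u * monomial v = monomial (u @ v)"
  by (simp add: mult_single plus_word_def)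

lemma monomial_Nil: "monomial [] = 1"
  by (simp add: zero_word_def[symmetric])

lemma prod_list_var: "prod_list (map var ks) = monomial ks"
  by (induction ks) (simp_all add: monomial_Nil var_def monomial_mult)

lemma const_mult_single: "const c * Poly_Mapping.single w d = Poly_Mapping.single w (c * d)"
  by (simp add: const_def mult_single)

lemma const_commute: "const c * p = p * const c"
  unfolding const_def
proof (induction p rule: Poly_Mapping.update_induct)
  case const
  then show ?case by simp
next
  case (update p a b)
  have "Poly_Mapping.update a b p = p + Poly_Mapping.single a b"
    using update by (intro poly_mapping_eqI)
      (auto simp: lookup_update lookup_add lookup_single in_keys_iff when_def)
  then show ?case using update by (simp add: distrib_left distrib_right mult_single mult.commute)
qed

lemma mult_const_left: "p * (const c * q) = const c * (p * q)"
  unfolding mult.assoc[symmetric] const_commute[of c p] ..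

lemma of_int_eq_const: "of_int i = const (of_int i)"
  unfolding const_def by simp

lemma poly_eq_sum_monomials: "p = (\<Sum>w\<in>Poly_Mapping.keys p. const (Poly_Mapping.lookup p w) * monomial (letters w))"
proof (rule poly_mapping_eqI)
  fix w
  show "Poly_Mapping.lookup p w = Poly_Mapping.lookup (\<Sum>w\<in>Poly_Mapping.keys p. const (Poly_Mapping.lookup p w) * monomial (letters w)) w"
    by (simp add: const_mult_single lookup_sum lookup_single when_def in_keys_iff)
qed

lemma alt_vars:
  "alt (map var ks) = (\<Sum>\<sigma> | \<sigma> permutes {..<length ks}. of_int (sign \<sigma>) * monomial (permute_list \<sigma> ks))"
  unfolding alt_def by (simp add: permute_list_map prod_list_var)

text \<open>
  A linear function on the free algebra is given by its values on words. The scalar multiplication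
  is a parameter so that the values can be taken in \<open>L\<close> and in the field itself.
\<close>
definition lin_ext :: "('f::field \<Rightarrow> 'v::ab_group_add \<Rightarrow> 'v) \<Rightarrow> (nat list \<Rightarrow> 'v) \<Rightarrow> (nat word \<Rightarrow>\<^sub>0 'f) \<Rightarrow> 'v" where
  "lin_ext scale f p = (\<Sum>w\<in>Poly_Mapping.keys p. scale (Poly_Mapping.lookup p w) (f (letters w)))"

lemma keys_const_mult: "Poly_Mapping.keys (const c * p) \<subseteq> Poly_Mapping.keys p"
  using Poly_Mapping.keys_mult[of "const c" p] by (auto simp: const_def split: if_splits)

lemma keys_alt_vars:
  "Poly_Mapping.keys (alt (map var ks) :: nat word \<Rightarrow>\<^sub>0 'f::field) \<subseteq> {w. mset (letters w) = mset ks}"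
proof
  fix w assume "w \<in> Poly_Mapping.keys (alt (map var ks) :: nat word \<Rightarrow>\<^sub>0 'f)"
  then obtain \<sigma> where \<sigma>: "\<sigma> permutes {..<length ks}"
    and w: "w \<in> Poly_Mapping.keys (of_int (sign \<sigma>) * monomial (permute_list \<sigma> ks) :: nat word \<Rightarrow>\<^sub>0 'f)"
    unfolding alt_vars using Poly_Mapping.keys_sum by fastforce
  have "w = Word (permute_list \<sigma> ks)"
    using w keys_const_mult[of "of_int (sign \<sigma>)" "monomial (permute_list \<sigma> ks) :: nat word \<Rightarrow>\<^sub>0 'f"]
    by (auto simp: of_int_eq_const split: if_splits)
  then show "w \<in> {w. mset (letters w) = mset ks}" using \<sigma> by simp
qed

lemma keys_alt_vars_minus_leading:
  assumes "distinct ks" "w \<in> Poly_Mapping.keys (alt (map var ks) - monomial ks :: nat word \<Rightarrow>\<^sub>0 'f::field)"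
  shows "mset (letters w) = mset ks \<and> letters w \<noteq> ks"
proof -
  let ?P = "{\<sigma>. \<sigma> permutes {..<length ks}}"
  have "alt (map var ks) = monomial ks +
      (\<Sum>\<sigma>\<in>?P - {id}. of_int (sign \<sigma>) * (monomial (permute_list \<sigma> ks) :: nat word \<Rightarrow>\<^sub>0 'f))"
    unfolding alt_vars
    by (subst sum.remove[of _ id]) (simp_all add: finite_permutations permutes_id)
  then have "w \<in> Poly_Mapping.keys (\<Sum>\<sigma>\<in>?P - {id}. of_int (sign \<sigma>) * (monomial (permute_list \<sigma> ks) :: nat word \<Rightarrow>\<^sub>0 'f))"
    using assms(2) by simp
  then obtain \<sigma> where \<sigma>: "\<sigma> permutes {..<length ks}" "\<sigma> \<noteq> id"
    and w: "w \<in> Poly_Mapping.keys (of_int (sign \<sigma>) * monomial (permute_list \<sigma> ks) :: nat word \<Rightarrow>\<^sub>0 'f)"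
    using Poly_Mapping.keys_sum by fastforce
  have "w = Word (permute_list \<sigma> ks)"
    using w keys_const_mult[of "of_int (sign \<sigma>)" "monomial (permute_list \<sigma> ks) :: nat word \<Rightarrow>\<^sub>0 'f"]
    by (auto simp: of_int_eq_const split: if_splits)
  then show ?thesis
    using \<sigma> permute_list_inj[OF assms(1) \<sigma>(1) permutes_id] by auto
qed

context vector_space
begin

lemma lin_ext_eq_sum:
  assumes "finite S" "Poly_Mapping.keys p \<subseteq> S"
  shows "lin_ext scale f p = (\<Sum>w\<in>S. scale (Poly_Mapping.lookup p w) (f (letters w)))"
  unfolding lin_ext_def using assms by (intro sum.mono_neutral_left) (auto simp: in_keys_iff)

lemma lin_ext_zero: "lin_ext scale f 0 = 0"
  by (simp add: lin_ext_def)

lemma lin_ext_single: "lin_ext scale f (Poly_Mapping.single w c) = scale c (f (letters w))"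
  by (simp add: lin_ext_def)

lemma lin_ext_add: "lin_ext scale f (p + q) = lin_ext scale f p + lin_ext scale f q"
proof -
  let ?S = "Poly_Mapping.keys p \<union> Poly_Mapping.keys q"
  have "lin_ext scale f (p + q) = (\<Sum>w\<in>?S. scale (Poly_Mapping.lookup (p + q) w) (f (letters w)))"
    by (rule lin_ext_eq_sum) (use Poly_Mapping.keys_add[of p q] in auto)
  then show ?thesis
    by (simp add: lin_ext_eq_sum[of ?S] lookup_add scale_left_distrib sum.distrib)
qed

lemma lin_ext_uminus: "lin_ext scale f (- p) = - lin_ext scale f p"
  using lin_ext_add[of f p "- p"] by (simp add: lin_ext_zero eq_neg_iff_add_eq_0 add.commute)

lemma lin_ext_diff: "lin_ext scale f (p - q) = lin_ext scale f p - lin_ext scale f q"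
  using lin_ext_add[of f p "- q"] by (simp add: lin_ext_uminus)

lemma lin_ext_sum: "lin_ext scale f (\<Sum>i\<in>I. p i) = (\<Sum>i\<in>I. lin_ext scale f (p i))"
  by (induction I rule: infinite_finite_induct) (simp_all add: lin_ext_zero lin_ext_add)

lemma lin_ext_const_mult: "lin_ext scale f (const c * p) = scale c (lin_ext scale f p)"
proof -
  have "const c * p = (\<Sum>w\<in>Poly_Mapping.keys p. Poly_Mapping.single w (c * Poly_Mapping.lookup p w))"
    by (subst (1) poly_eq_sum_monomials[of p], unfold sum_distrib_left) (simp add: const_mult_single)
  then show ?thesis
    by (simp only: lin_ext_sum lin_ext_single) (simp add: lin_ext_def scale_sum_right)
qed

text \<open>Expands the middle factor of a product into its monomials, the form in which
  induction over words can be applied to elements of an ideal.\<close>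
lemma lin_ext_sandwich:
  "lin_ext scale f (p * q * r) = (\<Sum>w\<in>Poly_Mapping.keys q. scale (Poly_Mapping.lookup q w) (lin_ext scale f (p * monomial (letters w) * r)))"
proof -
  have "p * q * r = (\<Sum>w\<in>Poly_Mapping.keys q. const (Poly_Mapping.lookup q w) * (p * monomial (letters w) * r))"
    by (subst poly_eq_sum_monomials[of q])
      (simp add: sum_distrib_left sum_distrib_right mult.assoc[symmetric] const_commute[of _ p])
  then show ?thesis by (simp add: lin_ext_sum lin_ext_const_mult)
qed

lemma lin_ext_shift_context: "lin_ext scale f (monomial u * p * monomial v) = lin_ext scale (\<lambda>w. f (u @ w @ v)) p"
  by (subst lin_ext_sandwich) (simp add: lin_ext_def[of _ _ p] mult_single plus_word_def lin_ext_single)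

lemma lin_ext_alt_vars:
  "lin_ext scale f (alt (map var ks)) =
     (\<Sum>\<sigma> | \<sigma> permutes {..<length ks}. scale (of_int (sign \<sigma>)) (f (permute_list \<sigma> ks)))"
  unfolding alt_vars lin_ext_sum
  by (simp add: of_int_eq_const lin_ext_const_mult lin_ext_single)

lemma lin_ext_comp:
  fixes L :: "'b \<Rightarrow> 'b"
  assumes add: "\<And>x y. L (x + y) = L x + L y" and hom: "\<And>c x. L (scale c x) = scale c (L x)"
  shows "lin_ext scale (\<lambda>w. L (g w)) p = L (lin_ext scale g p)"
proof -
  have "L 0 = 0" using hom[of 0 0] by simp
  then have "L (\<Sum>i\<in>I. h i) = (\<Sum>i\<in>I. L (h i))" for I :: "nat word set" and h
    by (induction I rule: infinite_finite_induct) (simp_all add: add)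
  then show ?thesis unfolding lin_ext_def by (simp add: hom)
qed

end

lemma (in vector_space) eq_uminus_self_imp_zero:
  fixes x :: 'b
  assumes "CHAR('a) \<noteq> 2" "x = - x"
  shows "x = 0"
proof -
  have "(2 :: 'a) \<noteq> 0"
  proof
    assume "(2 :: 'a) = 0"
    then have "CHAR('a) dvd 2" using of_nat_eq_0_iff_char_dvd[of 2, where 'a = 'a] by simp
    then have "CHAR('a) = 1 \<or> CHAR('a) = 2" using two_is_prime_nat prime_nat_iff by blast
    then show False using assms(1) CHAR_not_1[where 'a = 'a] by simp
  qed
  moreover have "scale 2 x = 0"
    using assms(2) scale_left_distrib[of 1 1 x] by (simp add: eq_neg_iff_add_eq_0)
  ultimately show ?thesis by simp
qed

context vector_space
begin

text \<open>
  Composing with the transposition of the two positions, \<open>i\<close> and \<open>i + d + 1\<close>, changes the sign of a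
  permutation but not the value of \<open>g\<close>, so the alternating sum equals its own negative.
\<close>
lemma lin_ext_alt_vars_zero:
  fixes g :: "nat list \<Rightarrow> 'b"
  assumes char: "CHAR('a) \<noteq> 2" and len: "i + d + 2 \<le> length ks"
    and sym: "\<And>X a Y b Z. length X = i \<Longrightarrow> length Y = d \<Longrightarrow> length (X @ a # Y @ b # Z) = length ks \<Longrightarrow>
      g (X @ a # Y @ b # Z) = g (X @ b # Y @ a # Z)"
  shows "lin_ext scale g (alt (map var ks)) = 0"
proof -
  let ?\<tau> = "transpose i (Suc (i + d))" and ?P = "{\<sigma>. \<sigma> permutes {..<length ks}}"
  let ?F = "\<lambda>\<sigma>. scale (of_int (sign \<sigma>)) (g (permute_list \<sigma> ks))"
  have \<tau>: "?\<tau> permutes {..<length ks}" using len by (intro permutes_swap_id) auto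
  have "(\<Sum>\<sigma>\<in>?P. ?F \<sigma>) = (\<Sum>\<sigma>\<in>?P. ?F (\<sigma> \<circ> ?\<tau>))"
    by (rule sum_permutations_compose_right[OF \<tau>])
  also have "\<dots> = (\<Sum>\<sigma>\<in>?P. - ?F \<sigma>)"
  proof (intro sum.cong refl)
    fix \<sigma> assume "\<sigma> \<in> ?P"
    then have \<sigma>: "\<sigma> permutes {..<length ks}" by simp
    have "sign (\<sigma> \<circ> ?\<tau>) = - sign \<sigma>"
      using permutation_permutes \<sigma> \<tau> by (subst sign_compose) (auto simp: sign_swap_id)
    moreover have "g (permute_list (\<sigma> \<circ> ?\<tau>) ks) = g (permute_list \<sigma> ks)"
    proof -
      let ?w = "permute_list \<sigma> ks"
      have "i < Suc (i + d)" "Suc (i + d) < length ?w" using len by auto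
      from split_list_two_positions[OF this] obtain X Y Z where
        w: "?w = X @ ?w ! i # Y @ ?w ! Suc (i + d) # Z" "length X = i" "length Y = d"
        by (metis add_diff_cancel_left' diff_Suc_Suc)
      have "permute_list (\<sigma> \<circ> ?\<tau>) ks = permute_list ?\<tau> ?w"
        by (rule permute_list_compose[OF \<tau>])
      also have "\<dots> = X @ ?w ! Suc (i + d) # Y @ ?w ! i # Z"
        using permute_list_transpose[of X Y "?w ! i" "?w ! Suc (i + d)" Z] w by metis
      finally show ?thesis
        using sym[OF w(2,3), of "?w ! i" "?w ! Suc (i + d)" Z] w(1) by (metis length_permute_list)
    qed
    ultimately show "?F (\<sigma> \<circ> ?\<tau>) = - ?F \<sigma>" by simp
  qed
  finally have "(\<Sum>\<sigma>\<in>?P. ?F \<sigma>) = - (\<Sum>\<sigma>\<in>?P. ?F \<sigma>)" by (simp add: sum_negf)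
  then show ?thesis
    unfolding lin_ext_alt_vars by (rule eq_uminus_self_imp_zero[OF char])
qed

end

text \<open>
  The linear-algebra core of the diamond lemma. An entry \<open>(w, p)\<close> of \<open>T\<close> is a polynomial \<open>p\<close> with
  leading word \<open>w\<close>, and requiring \<open>p\<close> to be sent to zero prescribes the value at \<open>w\<close> from the values
  at smaller words. Several entries may share a leading word; \<open>compat\<close> says that they
  prescribe the same value once all entries with smaller leading word are sent to zero.
\<close>
lemma (in vector_space) triangular_functional:
  fixes R :: "(nat list \<times> nat list) set" and T :: "(nat list \<times> (nat word \<Rightarrow>\<^sub>0 'a)) set"
  assumes wf: "wf R"
    and lower: "\<And>w p x. (w, p) \<in> T \<Longrightarrow> x \<in> Poly_Mapping.keys (p - monomial w) \<Longrightarrow> (letters x, w) \<in> R"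
    and compat: "\<And>w p q f. (w, p) \<in> T \<Longrightarrow> (w, q) \<in> T \<Longrightarrow>
       (\<And>x r. (x, r) \<in> T \<Longrightarrow> (x, w) \<in> R \<Longrightarrow> lin_ext scale f r = 0) \<Longrightarrow>
       lin_ext scale f p = lin_ext scale f q"
  shows "\<exists>f. (\<forall>(w, p)\<in>T. lin_ext scale f p = 0) \<and> (\<forall>w. w \<notin> fst ` T \<longrightarrow> f w = g w)"
proof -
  define P where "P w = (SOME p. (w, p) \<in> T)" for w
  define F where "F f w = (if w \<in> fst ` T then - lin_ext scale f (P w - monomial w) else g w)"
    for f :: "nat list \<Rightarrow> 'b" and w
  define f where "f = wfrec R F"
  have P: "(w, P w) \<in> T" if "w \<in> fst ` T" for w
    using that unfolding P_def by (metis (mono_tags, lifting) fst_conv image_iff prod.collapse someI)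
  have "f w = F (cut f R w) w" for w
    unfolding f_def by (rule wfrec[OF wf])
  also have "F (cut f R w) w = F f w" for w
  proof (cases "w \<in> fst ` T")
    case True
    then have "lin_ext scale (cut f R w) (P w - monomial w) = lin_ext scale f (P w - monomial w)"
      unfolding lin_ext_def by (intro sum.cong refl) (simp add: cut_apply lower[OF P])
    then show ?thesis by (simp add: F_def)
  qed (simp add: F_def)
  finally have f: "f w = F f w" for w .
  have "lin_ext scale f p = 0" if "(w, p) \<in> T" for w p
    using wf that
  proof (induction w arbitrary: p rule: wf_induct_rule)
    case (less w)
    have w: "w \<in> fst ` T" using less.prems by force
    have "lin_ext scale f (P w) = lin_ext scale f (P w - monomial w) + f w"
      by (simp add: lin_ext_diff lin_ext_single)
    also have "\<dots> = 0" using w f[of w] by (simp add: F_def)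
    finally show ?case
      using compat[OF less.prems P[OF w], of f] less.IH by simp
  qed
  moreover have "f w = g w" if "w \<notin> fst ` T" for w
    using f[of w] that by (simp add: F_def)
  ultimately show ?thesis by (intro exI[of _ f]) auto
qed

section \<open>A criterion for injectivity of the natural map\<close>

context n_lie_algebra
begin

abbreviation ev :: "(nat list \<Rightarrow> 'v) \<Rightarrow> (nat word \<Rightarrow>\<^sub>0 'f) \<Rightarrow> 'v" where
  "ev \<equiv> lin_ext scale"

abbreviation coord :: "'v list \<Rightarrow> 'v \<Rightarrow> nat \<Rightarrow> 'f" where
  "coord es v k \<equiv> representation (set es) v (es ! k)"

text \<open>
  Differs by a unit from the defining relation of the envelope, so that it generates the same ideal.
  Its coefficient at the increasing word is \<open>1\<close>.
\<close>
definition alt_relation :: "'v list \<Rightarrow> nat \<Rightarrow> (nat word \<Rightarrow>\<^sub>0 'f)" where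
  "alt_relation es k = alt (map var (omit k [0..<n + 1])) - phi es (bracket (omit k es))"

lemma env_relation_eq: "env_relation es k = const ((-1) ^ (n div 2)) * alt_relation es k"
proof -
  have "(-1) ^ m = (const ((-1) ^ m) :: nat word \<Rightarrow>\<^sub>0 'f)" for m
    using of_int_eq_const[of "(-1) ^ m"] by simp
  then show ?thesis
    by (simp add: env_relation_def alt_relation_def map_omit)
qed

lemma coord_expansion:
  assumes "ordered_basis es"
  shows "(\<Sum>k<length es. scale (coord es v k) (es ! k)) = v"
proof -
  have d: "distinct es" and "(\<Sum>b\<in>set es. scale (representation (set es) v b) b) = v"
    using assms unfolding ordered_basis_def by (auto intro!: sum_representation_eq)
  then show ?thesis
    using sum.reindex_bij_betw[OF bij_betw_nth[OF d refl refl], of "\<lambda>b. scale (representation (set es) v b) b"]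
    by simp
qed

lemma coord_basis:
  assumes "ordered_basis es" "j < length es" "k < length es"
  shows "coord es (es ! j) k = (if k = j then 1 else 0)"
  using assms unfolding ordered_basis_def
  by (subst representation_basis) (auto simp: nth_eq_iff_index_eq)

lemma ev_phi: "ev f (phi es v) = (\<Sum>k<length es. scale (coord es v k) (f [k]))"
  unfolding phi_def lin_ext_sum by (simp add: lin_ext_const_mult lin_ext_single var_def)

lemma keys_phi: "Poly_Mapping.keys (phi es v) \<subseteq> {w. \<exists>k<length es. letters w = [k]}"
proof -
  have "Poly_Mapping.keys (phi es v)
      \<subseteq> (\<Union>k<length es. Poly_Mapping.keys (const (coord es v k) * var k))"
    unfolding phi_def by (rule Poly_Mapping.keys_sum)
  also have "\<dots> \<subseteq> {w. \<exists>k<length es. letters w = [k]}"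
    by (auto simp: var_def const_mult_single split: if_splits)
  finally show ?thesis .
qed

lemma keys_alt_relation:
  "Poly_Mapping.keys (alt_relation es k) \<subseteq>
     {w. mset (letters w) = mset (omit k [0..<n + 1]) \<or> (\<exists>j<length es. letters w = [j])}"
proof -
  have "Poly_Mapping.keys (alt_relation es k) \<subseteq> Poly_Mapping.keys (alt (map var (omit k [0..<n + 1])) :: nat word \<Rightarrow>\<^sub>0 'f)
      \<union> Poly_Mapping.keys (phi es (bracket (omit k es)))"
    unfolding alt_relation_def by (rule Poly_Mapping.keys_diff)
  then show ?thesis
    using keys_alt_vars[of "omit k [0..<n + 1]"] keys_phi[of es "bracket (omit k es)"] by blast
qed

lemma env_relation_in_free_algebra:
  assumes "length es = n + 1"
  shows "env_relation es k \<in> carrier (free_algebra (n + 1))"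
proof -
  have "set (letters w) \<subseteq> {..<n + 1}" if "w \<in> Poly_Mapping.keys (env_relation es k)" for w
  proof -
    have "w \<in> Poly_Mapping.keys (alt_relation es k)"
      using that keys_const_mult unfolding env_relation_eq by blast
    then have "mset (letters w) = mset (omit k [0..<n + 1]) \<or> (\<exists>j<n + 1. letters w = [j])"
      using keys_alt_relation[of es k] assms by auto
    then show ?thesis
    proof
      assume "mset (letters w) = mset (omit k [0..<n + 1])"
      then have "set (letters w) = {..<n + 1} - {k}"
        using set_omit_upt[of k "n + 1"] by (metis mset_eq_setD)
      then show ?thesis by blast
    qed auto
  qed
  then show ?thesis unfolding free_algebra_def by simp
qed

text \<open>
  The polynomials \<open>p\<close> such that \<open>f\<close> vanishes on all \<open>u p v\<close> form a two-sided ideal. By \<open>kill\<close> it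
  contains the relations, hence the ideal they generate. So \<open>f\<close> is well defined on the envelope, and
  by \<open>gen\<close> it is a left inverse of the natural map.
\<close>
lemma inj_env_map_criterion:
  assumes es: "ordered_basis es" "length es = n + 1"
    and gen: "\<And>k. k \<le> n \<Longrightarrow> f [k] = es ! k"
    and kill: "\<And>u k v. k \<le> n \<Longrightarrow> ev f (monomial u * alt_relation es k * monomial v) = 0"
  shows "inj (env_map es)"
proof -
  let ?FA = "free_algebra (n + 1) :: (nat word \<Rightarrow>\<^sub>0 'f) ring"
  interpret R: ring ?FA by (rule ring_free_algebra)
  have ops: "p \<oplus>\<^bsub>free_algebra m\<^esub> q = p + q" "p \<otimes>\<^bsub>free_algebra m\<^esub> q = p * q"
    "\<zero>\<^bsub>free_algebra m\<^esub> = (0 :: nat word \<Rightarrow>\<^sub>0 'f)" for p q :: "nat word \<Rightarrow>\<^sub>0 'f" and m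
    unfolding free_algebra_def by simp_all
  have um: "- p \<in> carrier ?FA" if "p \<in> carrier ?FA" for p
    using that unfolding free_algebra_def by simp
  have neg: "\<ominus>\<^bsub>?FA\<^esub> p = - p" if "p \<in> carrier ?FA" for p
    using that um by (intro R.minus_equality) (simp_all add: ops)
  define K where "K = {p \<in> carrier ?FA. \<forall>u v. ev f (monomial u * p * monomial v) = 0}"
  have "ideal K ?FA"
  proof (rule idealI)
    show "subgroup K (add_monoid ?FA)"
    proof
      show "K \<subseteq> carrier (add_monoid ?FA)" unfolding K_def by auto
      show "x \<otimes>\<^bsub>add_monoid ?FA\<^esub> y \<in> K" if "x \<in> K" "y \<in> K" for x y
        using that R.a_closed[of x y] unfolding K_def
        by (simp add: ops distrib_left distrib_right lin_ext_add)
      show "\<one>\<^bsub>add_monoid ?FA\<^esub> \<in> K"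
        using R.zero_closed unfolding K_def by (simp add: ops lin_ext_zero)
      show "inv\<^bsub>add_monoid ?FA\<^esub> x \<in> K" if "x \<in> K" for x
      proof -
        have x: "x \<in> carrier ?FA" using that unfolding K_def by simp
        have "inv\<^bsub>add_monoid ?FA\<^esub> x = - x" using neg[OF x] unfolding a_inv_def .
        then show ?thesis using that um unfolding K_def by (simp add: lin_ext_uminus)
      qed
    qed
    show "x \<otimes>\<^bsub>?FA\<^esub> a \<in> K" if "a \<in> K" "x \<in> carrier ?FA" for a x
    proof -
      have "ev f (monomial u * (x * a) * monomial v) = 0" for u v
        using lin_ext_sandwich[of f "monomial u" x "a * monomial v"] that(1)
        unfolding K_def by (simp add: mult.assoc[symmetric] mult_single plus_word_def)
      then show ?thesis using that R.m_closed[of x a] unfolding K_def by (simp add: ops)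
    qed
    show "a \<otimes>\<^bsub>?FA\<^esub> x \<in> K" if "a \<in> K" "x \<in> carrier ?FA" for a x
    proof -
      have "ev f (monomial u * a * monomial (letters w @ v)) = 0" for u w v
        using that(1) unfolding K_def by simp
      then have "ev f (monomial u * a * monomial (letters w) * monomial v) = 0" for u w v
        by (simp add: mult.assoc monomial_mult del: word.collapse)
      then have "ev f (monomial u * (a * x) * monomial v) = 0" for u v
        using lin_ext_sandwich[of f "monomial u * a" x "monomial v"]
        by (simp add: mult.assoc[symmetric] del: word.collapse)
      then show ?thesis using that R.m_closed[of a x] unfolding K_def by (simp add: ops)
    qed
  qed (rule ring_free_algebra)
  moreover have rel: "env_relation es k \<in> K" if "k \<le> n" for k
  proof -
    have "monomial u * env_relation es k * monomial v
        = const ((-1) ^ (n div 2)) * (monomial u * alt_relation es k * monomial v)" for u v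
      unfolding env_relation_eq by (simp only: mult_const_left mult.assoc)
    then show ?thesis
      using kill[OF that] env_relation_in_free_algebra[OF es(2), of k] unfolding K_def
      by (simp add: lin_ext_const_mult)
  qed
  ultimately have sub: "env_ideal es \<subseteq> K"
    unfolding env_ideal_def by (intro R.genideal_minimal) auto
  have idl: "ideal (env_ideal es) ?FA"
    unfolding env_ideal_def
    by (rule R.genideal_ideal) (use env_relation_in_free_algebra[OF es(2)] in auto)
  have val: "ev f (phi es v) = v" for v
    using coord_expansion[OF es(1), of v] gen es(2) by (simp add: ev_phi)
  show ?thesis
  proof (rule injI)
    fix v w assume eq: "env_map es v = env_map es w"
    have c: "phi es x \<in> carrier ?FA" for x
      using phi_in_free_algebra[of es x] es(2) by simp
    have "phi es v \<ominus>\<^bsub>?FA\<^esub> phi es w \<in> env_ideal es"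
      using eq R.quotient_eq_iff_same_a_r_cos[OF idl c c] unfolding env_map_def by simp
    then have "phi es v - phi es w \<in> K"
      using sub c neg by (auto simp: a_minus_def ops)
    then have "ev f (monomial [] * (phi es v - phi es w) * monomial []) = 0"
      unfolding K_def by blast
    then show "v = w" by (simp add: monomial_Nil lin_ext_diff val)
  qed
qed

end

section \<open>Symmetric structure constants\<close>

text \<open>
  Larger letters come first in this order, so that the increasing arrangement is the greatest. The
  bound \<open>m\<close> keeps the reversed order of the letters well-founded.
\<close>
lemma permutation_of_sorted_lenlex:
  assumes "sorted_wrt (<) c" "distinct w" "set w = set c" "set c \<subseteq> {..m}" "w \<noteq> c"
  shows "(w, c) \<in> lenlex (measure (\<lambda>a. m - a))"
  using assms
proof (induction c arbitrary: w)
  case (Cons a c)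
  then obtain b w' where w: "w = b # w'" by (cases w) auto
  have "length w = length (a # c)"
    using Cons.prems by (metis distinct_card strict_sorted_iff)
  then have len: "length w' = length c" using w by simp
  show ?case
  proof (cases "b = a")
    case True
    have "a \<notin> set c" using Cons.prems(1) by auto
    then have "set w' = set c" using Cons.prems(2,3) w True by auto
    then have "(w', c) \<in> lenlex (measure (\<lambda>a. m - a))"
      using Cons.prems w True by (intro Cons.IH) auto
    then show ?thesis by (simp add: w True Cons_lenlex_iff)
  next
    case False
    then have "b \<in> set c" using Cons.prems(3) w by auto
    then have "a < b" "b \<le> m" using Cons.prems(1,4) by auto
    then show ?thesis using len by (simp add: w Cons_lenlex_iff)
  qed
qed auto

lemma lenlex_context:
  assumes "(x, c) \<in> lenlex (measure f)"
  shows "(u @ x @ v, u @ c @ v) \<in> lenlex (measure f)"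
proof -
  have "irrefl (measure f)" by (simp add: irrefl_def)
  then show ?thesis using lenlex_append1[OF assms, of v v] by simp
qed

lemma sorted_omit_upt: "sorted_wrt (<) (omit k [0..<m])"
proof (cases "k < m")
  case True
  then show ?thesis
    by (auto simp: omit_def take_upt drop_upt sorted_wrt_append)
next
  case False
  then show ?thesis by (simp add: omit_def)
qed

text \<open>
  The only ambiguity. Gluing two increasing words of length \<open>n\<close> along a nonempty \<open>t\<close> gives an
  increasing word, which has no room for more than \<open>n + 1\<close> letters.
\<close>
lemma omit_upt_overlap:
  assumes c: "s @ t = omit k [0..<n + 1]" "t @ y = omit l [0..<n + 1]"
    and k: "k \<le> n" and l: "l \<le> n" and s: "s \<noteq> []" and t: "t \<noteq> []"
  shows "s = [0]" "y = [n]" "k = n" "l = 0" "s @ t @ y = [0..<n + 1]"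
proof -
  let ?z = "s @ t @ y"
  have st: "sorted_wrt (<) (s @ t)" and ty: "sorted_wrt (<) (t @ y)"
    using sorted_omit_upt c by metis+
  have "a < b" if "a \<in> set s" "b \<in> set y" for a b
  proof -
    have "a < hd t" "hd t < b" using that st ty t by (auto simp: sorted_wrt_append)
    then show ?thesis by simp
  qed
  then have sorted: "sorted_wrt (<) ?z" using st ty by (auto simp: sorted_wrt_append)
  have "set (s @ t) \<subseteq> {..<n + 1}" "set (t @ y) \<subseteq> {..<n + 1}"
    unfolding c set_omit_upt by auto
  then have sub: "set ?z \<subseteq> {..<n + 1}" by auto
  have d: "distinct ?z" using sorted strict_sorted_iff by blast
  have lst: "length (s @ t) = n" "length (t @ y) = n"
    unfolding c using k l by (simp_all add: length_omit)
  have "length ?z \<le> n + 1"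
    using card_mono[OF _ sub] distinct_card[OF d] by simp
  then have ls: "length s = 1" "length y = 1" using lst s by (cases s; simp)+
  then have "card (set ?z) = n + 1" using distinct_card[OF d] lst by simp
  then have "set ?z = {..<n + 1}" using sub by (intro card_subset_eq) auto
  then have "set ?z = set [0..<n + 1]" by (simp only: set_upt atLeast0LessThan)
  then have z: "?z = [0..<n + 1]"
    by (rule strict_sorted_equal[OF sorted_wrt_upt sorted])
  then show "s @ t @ y = [0..<n + 1]" .
  have "s = take 1 ?z" "y = drop n ?z" "s @ t = take n ?z" "t @ y = drop 1 ?z"
    using ls lst by simp_all
  then have e: "s = [0]" "y = [n]" "s @ t = [0..<n]" "t @ y = [1..<n + 1]"
  proof -
    have "take 1 [0..<n + 1] = [0]" by (simp add: upt_conv_Cons del: upt_Suc)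
    moreover have "drop n [0..<n + 1] = [n]" "take n [0..<n + 1] = [0..<n]" by simp_all
    moreover have "drop 1 [0..<n + 1] = [1..<n + 1]" by (simp only: drop_upt) simp
    ultimately show "s = [0]" "y = [n]" "s @ t = [0..<n]" "t @ y = [1..<n + 1]"
      using \<open>s = take 1 ?z\<close> \<open>y = drop n ?z\<close> \<open>s @ t = take n ?z\<close> \<open>t @ y = drop 1 ?z\<close>
      unfolding z by simp_all
  qed
  then show "s = [0]" "y = [n]" by simp_all
  have "{..<n + 1} - {k} = {..<n}" 
    unfolding set_omit_upt[symmetric] c(1)[symmetric] e(3) by (simp add: atLeast0LessThan)
  then have "n \<in> {..<n + 1} - {k} \<longleftrightarrow> n \<in> {..<n}" by simp
  then show "k = n" by auto
  have "{..<n + 1} - {l} = {1..<n + 1}" 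
    unfolding set_omit_upt[symmetric] c(2)[symmetric] e(4) by (simp del: upt_Suc)
  then have "0 \<in> {..<n + 1} - {l} \<longleftrightarrow> 0 \<in> {1..<n + 1}" by simp
  then show "l = 0" by auto
qed

context n_lie_algebra
begin

text \<open>
  The alternating parts cancel because, for even \<open>n\<close>, the first-factor and the last-factor
  expansions of the alternating sum of all generators carry the same signs. The bracket parts cancel
  because a symmetric matrix is paired with commutators.
\<close>
lemma commutator_relation:
  assumes es: "ordered_basis es" "length es = n + 1" and n: "even n"
    and sym: "\<And>j k. j \<le> n \<Longrightarrow> k \<le> n \<Longrightarrow>
       (-1) ^ k * coord es (bracket (omit k es)) j = (-1) ^ j * coord es (bracket (omit j es)) k"
  shows "(\<Sum>k\<le>n. const ((-1) ^ k) * (var k * alt_relation es k - alt_relation es k * var k)) = 0"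
proof -
  let ?xs = "map var [0..<n + 1] :: (nat word \<Rightarrow>\<^sub>0 'f) list"
  let ?D = "\<lambda>k. alt (map var (omit k [0..<n + 1])) :: nat word \<Rightarrow>\<^sub>0 'f"
  let ?S = "\<lambda>k j. (-1) ^ k * coord es (bracket (omit k es)) j"
  have len: "length ?xs = Suc n" by simp
  have pow: "const ((-1) ^ k) = ((-1) ^ k :: nat word \<Rightarrow>\<^sub>0 'f)" for k
    using of_int_eq_const[of "(-1) ^ k", where 'a = 'f] by simp
  have nth: "?xs ! k = var k" if "k \<le> n" for k
    using that by (simp del: upt_Suc)
  have "(\<Sum>k\<le>n. const ((-1) ^ k) * (var k * ?D k)) = alt ?xs"
    unfolding alt_expand_first[OF len]
    by (intro sum.cong refl) (simp add: nth pow map_omit del: upt_Suc)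
  moreover have "(\<Sum>k\<le>n. const ((-1) ^ k) * (?D k * var k)) = alt ?xs"
    unfolding alt_expand_last[OF len]
    using n by (intro sum.cong refl) (simp add: nth pow map_omit power_add del: upt_Suc)
  ultimately have D: "(\<Sum>k\<le>n. const ((-1) ^ k) * (var k * ?D k - ?D k * var k)) = 0"
    by (simp add: right_diff_distrib sum_subtractf)
  have idx: "{..<length es} = {..n}" using es(2) by auto
  have cm: "const a * const b = (const (a * b) :: nat word \<Rightarrow>\<^sub>0 'f)" for a b
    by (simp add: const_def mult_single)
  have "(\<Sum>k\<le>n. const ((-1) ^ k) * (var k * phi es (bracket (omit k es))))
      = (\<Sum>k\<le>n. \<Sum>j\<le>n. const (?S k j) * (var k * var j))"
    unfolding phi_def idx sum_distrib_left cm[symmetric]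
    by (intro sum.cong refl) (simp only: mult_const_left[of "var _"] mult.assoc)
  also have "\<dots> = (\<Sum>j\<le>n. \<Sum>k\<le>n. const (?S j k) * (var k * var j))"
    by (subst sum.swap) (intro sum.cong refl, use sym in auto)
  also have "\<dots> = (\<Sum>k\<le>n. const ((-1) ^ k) * (phi es (bracket (omit k es)) * var k))"
    unfolding phi_def idx sum_distrib_left sum_distrib_right cm[symmetric]
    by (intro sum.cong refl) (simp add: mult.assoc)
  finally have "(\<Sum>k\<le>n. const ((-1) ^ k) * (var k * phi es (bracket (omit k es))
      - phi es (bracket (omit k es)) * var k)) = 0"
    by (simp add: right_diff_distrib sum_subtractf)
  with D have "(\<Sum>k\<le>n. const ((-1) ^ k) * (var k * ?D k - ?D k * var k)
      - const ((-1) ^ k) * (var k * phi es (bracket (omit k es))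
      - phi es (bracket (omit k es)) * var k)) = 0"
    by (simp only: sum_subtractf) simp
  then show ?thesis
    unfolding alt_relation_def by (simp add: algebra_simps)
qed

lemma alt_relation_lower:
  assumes "n \<ge> 2" "length es = n + 1" "k \<le> n"
    and "x \<in> Poly_Mapping.keys (alt_relation es k - monomial (omit k [0..<n + 1]))"
  shows "(letters x, omit k [0..<n + 1]) \<in> lenlex (measure (\<lambda>a. n - a))"
proof -
  let ?c = "omit k [0..<n + 1]"
  have sorted: "sorted_wrt (<) ?c" by (rule sorted_omit_upt)
  then have d: "distinct ?c" using strict_sorted_iff by blast
  have "alt_relation es k - monomial ?c = (alt (map var ?c) - monomial ?c) - phi es (bracket (omit k es))"
    unfolding alt_relation_def by simp
  then have "x \<in> Poly_Mapping.keys ((alt (map var ?c) - monomial ?c) - phi es (bracket (omit k es)))"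
    using assms(4) by (simp only:)
  then have "x \<in> Poly_Mapping.keys (alt (map var ?c) - monomial ?c :: nat word \<Rightarrow>\<^sub>0 'f)
      \<union> Poly_Mapping.keys (phi es (bracket (omit k es)))"
    by (rule subsetD[OF Poly_Mapping.keys_diff])
  then consider "x \<in> Poly_Mapping.keys (alt (map var ?c) - monomial ?c :: nat word \<Rightarrow>\<^sub>0 'f)"
    | "x \<in> Poly_Mapping.keys (phi es (bracket (omit k es)))"
    by blast
  then show ?thesis
  proof cases
    case 1
    then have x: "mset (letters x) = mset ?c" "letters x \<noteq> ?c"
      using keys_alt_vars_minus_leading[OF d] by auto
    show ?thesis
    proof (rule permutation_of_sorted_lenlex[OF sorted _ _ _ x(2)])
      show "distinct (letters x)" using d x(1) mset_eq_imp_distinct_iff by blast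
      show "set (letters x) = set ?c" using x(1) by (rule mset_eq_setD)
      show "set ?c \<subseteq> {..n}" unfolding set_omit_upt by auto
    qed
  next
    case 2
    then obtain j where "letters x = [j]" using keys_phi by blast
    moreover have "length ?c = n" using assms(3) by (simp add: length_omit)
    ultimately show ?thesis using assms(1) by (simp add: lenlex_conv)
  qed
qed

text \<open>
  The diamond lemma for the words in the generators: \<open>T\<close> consists of all multiples \<open>u r\<^sub>k v\<close> of the
  relations, each with its leading word. Two occurrences of leading words \<open>c\<^sub>k\<close>, \<open>c\<^sub>l\<close> in the same word
  coincide, are disjoint, or overlap as described by \<open>omit_upt_overlap\<close>.
\<close>
lemma inj_env_map_if_symmetric:
  assumes es: "ordered_basis es" "length es = n + 1" and n: "even n" "n \<ge> 2"
    and sym: "\<And>j k. j \<le> n \<Longrightarrow> k \<le> n \<Longrightarrow>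
       (-1) ^ k * coord es (bracket (omit k es)) j = (-1) ^ j * coord es (bracket (omit j es)) k"
  shows "inj (env_map es)"
proof -
  let ?R = "lenlex (measure (\<lambda>a. n - a))"
  define c where "c k = omit k [0..<n + 1]" for k
  define r where "r k = alt_relation es k" for k
  define T where "T = {(u @ c k @ v, monomial u * r k * monomial v) | u k v. k \<le> n}"
  have TI: "(u @ c k @ v, monomial u * r k * monomial v) \<in> T" if "k \<le> n" for u k v
    using that unfolding T_def by blast
  have len_c: "length (c k) = n" if "k \<le> n" for k
    using that unfolding c_def by (simp add: length_omit)
  have low: "(letters x, c k) \<in> ?R" if "k \<le> n" "x \<in> Poly_Mapping.keys (r k - monomial (c k))" for k x
    using alt_relation_lower[OF n(2) es(2)] that unfolding r_def c_def by blast
  have wf: "wf ?R" by (intro wf_lenlex wf_measure)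
  have lower: "(letters x, w) \<in> ?R"
    if T: "(w, p) \<in> T" and x: "x \<in> Poly_Mapping.keys (p - monomial w)" for w p x
  proof -
    obtain u k v where k: "k \<le> n" and w: "w = u @ c k @ v" and p: "p = monomial u * r k * monomial v"
      using T unfolding T_def by blast
    have "p - monomial w = monomial u * (r k - monomial (c k)) * monomial v"
      unfolding p w by (simp add: left_diff_distrib right_diff_distrib monomial_mult)
    then obtain y where y: "y \<in> Poly_Mapping.keys (r k - monomial (c k))" and "letters x = u @ letters y @ v"
      using x Poly_Mapping.keys_mult[of "monomial u * (r k - monomial (c k))" "monomial v"]
        Poly_Mapping.keys_mult[of "monomial u" "r k - monomial (c k)"]
      by (fastforce simp: plus_word_def)
    then show ?thesis using lenlex_context[OF low[OF k y]] unfolding w by simp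
  qed
  have compat_aux: "ev f (monomial u * r k * monomial v) = ev f (monomial u' * r l * monomial v')"
    if eq: "u @ c k @ v = u' @ c l @ v'" and k: "k \<le> n" and l: "l \<le> n"
      and le: "length u \<le> length u'"
      and IH: "\<And>x p. (x, p) \<in> T \<Longrightarrow> (x, u @ c k @ v) \<in> ?R \<Longrightarrow> ev f p = 0"
    for f u k v u' l v'
  proof -
    obtain s where u': "u' = u @ s"
      using eq le by (metis append_eq_append_conv_if append_take_drop_id)
    have eq': "c k @ v = s @ c l @ v'" using eq unfolding u' by simp
    consider "s = []" | "length s \<ge> n" | "s \<noteq> []" "length s < n" by linarith
    then show ?thesis
    proof cases
      case 1
      then have "c k = c l" "v = v'" using eq' len_c[OF k] len_c[OF l] by auto
      moreover have "k = l"
      proof -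
        have "{..<n + 1} - {k} = {..<n + 1} - {l}"
          using \<open>c k = c l\<close> set_omit_upt[of k "n + 1"] set_omit_upt[of l "n + 1"] unfolding c_def by simp
        then show ?thesis using k l by (metis DiffE DiffI insertI1 le_imp_less_Suc lessThan_iff Suc_eq_plus1 singletonD)
      qed
      ultimately show ?thesis using 1 u' by simp
    next
      case 2
      then obtain m where s: "s = c k @ m"
        using eq' len_c[OF k] by (metis append_eq_append_conv_if append_take_drop_id)
      then have v: "v = m @ c l @ v'" using eq' by simp
      \<comment> \<open>Disjoint occurrences: reducing one of them in \<open>?Q\<close> leaves multiples of the other relation with
        smaller leading words, so both sides agree with the value at \<open>?Q\<close>.\<close>
      let ?Q = "monomial u * r k * monomial m * r l * monomial v'"
      have "ev f (monomial u * r k * monomial m * (r l - monomial (c l)) * monomial v') = 0"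
      proof (subst lin_ext_sandwich, intro sum.neutral ballI)
        fix x assume x: "x \<in> Poly_Mapping.keys (r l - monomial (c l))"
        have "(u @ c k @ m @ letters x @ v', u @ c k @ v) \<in> ?R"
          using lenlex_context[OF low[OF l x], of "u @ c k @ m" v'] unfolding v by simp
        then have "ev f (monomial u * r k * monomial (m @ letters x @ v')) = 0"
          using IH TI[OF k, of u "m @ letters x @ v'"] by blast
        then show "scale (Poly_Mapping.lookup (r l - monomial (c l)) x)
            (ev f (monomial u * r k * monomial m * monomial (letters x) * monomial v')) = 0"
          by (simp only: mult.assoc monomial_mult) simp
      qed
      then have 1: "ev f ?Q = ev f (monomial u * r k * monomial v)"
        unfolding v by (simp add: right_diff_distrib left_diff_distrib lin_ext_diff mult.assoc monomial_mult)
      have "ev f (monomial u * (r k - monomial (c k)) * (monomial m * r l * monomial v')) = 0"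
      proof (subst lin_ext_sandwich, intro sum.neutral ballI)
        fix x assume x: "x \<in> Poly_Mapping.keys (r k - monomial (c k))"
        have "(u @ letters x @ v, u @ c k @ v) \<in> ?R"
          using lenlex_context[OF low[OF k x], of u v] .
        then have "ev f (monomial (u @ letters x @ m) * r l * monomial v') = 0"
          using IH TI[OF l, of "u @ letters x @ m" v'] unfolding v by simp
        then show "scale (Poly_Mapping.lookup (r k - monomial (c k)) x)
            (ev f (monomial u * monomial (letters x) * (monomial m * r l * monomial v'))) = 0"
          by (simp only: mult.assoc[symmetric] monomial_mult append_assoc) simp
      qed
      then have "ev f ?Q = ev f (monomial u' * r l * monomial v')"
        unfolding u' s monomial_mult[symmetric]
        by (simp only: right_diff_distrib left_diff_distrib lin_ext_diff mult.assoc) simp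
      with 1 show ?thesis by simp
    next
      case 3
      then obtain t where t: "c k = s @ t" "t \<noteq> []"
        using eq' len_c[OF k]
        by (metis append_Nil2 append_eq_append_conv_if append_take_drop_id less_imp_le less_irrefl)
      then have tv: "t @ v = c l @ v'" using eq' by simp
      moreover have "length t \<le> length (c l)" using t(1) len_c[OF k] len_c[OF l] by (metis length_append le_add2)
      ultimately obtain y where y: "c l = t @ y" "v = y @ v'"
        by (metis append_eq_append_conv_if append_take_drop_id same_append_eq append_assoc)
      note ov = omit_upt_overlap[OF t(1)[unfolded c_def, symmetric] y(1)[unfolded c_def, symmetric] k l 3(1) t(2)]
      have w: "u @ c k @ v = u @ [0..<n + 1] @ v'" unfolding t(1) y(2) using ov(5) by simp
      \<comment> \<open>In the commutator relation, multiplied by \<open>u\<close> and \<open>v'\<close>, all terms except \<open>a 0\<close> and \<open>b n\<close> have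
        a leading word below the full increasing word.\<close>
      define a where "a i = ev f (monomial (u @ [i]) * r i * monomial v')" for i
      define b where "b i = ev f (monomial u * r i * monomial (i # v'))" for i
      have small: "(u @ x @ v', u @ c k @ v) \<in> ?R"
        if "distinct x" "set x = {..n}" "x \<noteq> [0..<n + 1]" for x
      proof -
        have "set x = set [0..<n + 1]" "set [0..<n + 1] \<subseteq> {..n}"
          unfolding that(2) set_upt by auto
        then show ?thesis
          unfolding w
          by (intro lenlex_context permutation_of_sorted_lenlex[OF sorted_wrt_upt that(1) _ _ that(3)])
      qed
      have dc: "distinct (c i)" for i
        using sorted_omit_upt[of i "n + 1"] strict_sorted_iff unfolding c_def by blast
      have a0: "a i = 0" if i: "i \<le> n" "i \<noteq> 0" for i
      proof -
        have "i # c i \<noteq> [0..<n + 1]" using i by (simp add: upt_conv_Cons del: upt_Suc)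
        then have "(u @ (i # c i) @ v', u @ c k @ v) \<in> ?R"
          using i dc by (intro small) (auto simp: c_def set_omit_upt simp del: upt_Suc)
        then show ?thesis
          using IH[OF TI[OF i(1), of "u @ [i]" v']] unfolding a_def by simp
      qed
      have b0: "b i = 0" if i: "i \<le> n" "i \<noteq> n" for i
      proof -
        have ne: "c i @ [i] \<noteq> [0..<n + 1]"
          using i by (auto dest!: arg_cong[of _ _ last])
        then have "(u @ (c i @ [i]) @ v', u @ c k @ v) \<in> ?R"
          using i dc by (intro small ne) (auto simp: c_def set_omit_upt simp del: upt_Suc)
        then show ?thesis
          using IH[OF TI[OF i(1), of u "i # v'"]] unfolding b_def by simp
      qed
      have "0 = ev f (monomial u * (\<Sum>i\<le>n. const ((-1) ^ i) * (var i * r i - r i * var i)) * monomial v')"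
        using commutator_relation[OF es n(1) sym] unfolding r_def by (simp add: lin_ext_zero)
      also have "\<dots> = (\<Sum>i\<le>n. ev f (const ((-1) ^ i) * (monomial u * (var i * r i - r i * var i) * monomial v')))"
        by (simp only: sum_distrib_left sum_distrib_right lin_ext_sum mult_const_left[of "monomial u"] mult.assoc)
      also have "\<dots> = (\<Sum>i\<le>n. scale ((-1) ^ i) (a i - b i))"
      proof (intro sum.cong refl)
        fix i
        have "monomial u * (var i * r i - r i * var i) * monomial v'
          = monomial (u @ [i]) * r i * monomial v' - monomial u * r i * monomial (i # v')"
        proof -
          have "monomial (u @ [i]) = monomial u * (var i :: nat word \<Rightarrow>\<^sub>0 'f)"
            "monomial (i # v') = (var i :: nat word \<Rightarrow>\<^sub>0 'f) * monomial v'"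
            by (simp_all add: var_def monomial_mult)
          then show ?thesis by (simp only: right_diff_distrib left_diff_distrib mult.assoc)
        qed
        then show "ev f (const ((-1) ^ i) * (monomial u * (var i * r i - r i * var i) * monomial v'))
            = scale ((-1) ^ i) (a i - b i)"
          by (simp add: lin_ext_const_mult lin_ext_diff a_def b_def)
      qed
      also have "\<dots> = (\<Sum>i\<le>n. scale ((-1) ^ i) (a i)) - (\<Sum>i\<le>n. scale ((-1) ^ i) (b i))"
        by (simp add: scale_right_diff_distrib sum_subtractf)
      also have "(\<Sum>i\<le>n. scale ((-1) ^ i) (a i)) = (\<Sum>i\<in>{0}. scale ((-1) ^ i) (a i))"
        by (rule sum.mono_neutral_right) (auto simp: a0)
      also have "(\<Sum>i\<le>n. scale ((-1) ^ i) (b i)) = (\<Sum>i\<in>{n}. scale ((-1) ^ i) (b i))"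
        by (rule sum.mono_neutral_right) (auto simp: b0)
      finally have "a 0 = b n" using n(1) by simp
      then show ?thesis
        using ov u' y(2) unfolding a_def b_def by simp
    qed
  qed
  have compat: "ev f p = ev f q"
    if p: "(w, p) \<in> T" and q: "(w, q) \<in> T"
      and IH: "\<And>x r. (x, r) \<in> T \<Longrightarrow> (x, w) \<in> ?R \<Longrightarrow> ev f r = 0" for w p q f
  proof -
    obtain u k v where 1: "k \<le> n" "w = u @ c k @ v" "p = monomial u * r k * monomial v"
      using p unfolding T_def by blast
    obtain u' l v' where 2: "l \<le> n" "w = u' @ c l @ v'" "q = monomial u' * r l * monomial v'"
      using q unfolding T_def by blast
    show ?thesis
    proof (cases "length u \<le> length u'")
      case True
      then show ?thesis using compat_aux[of u k v u' l v' f] 1 2 IH by auto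
    next
      case False
      then show ?thesis using compat_aux[of u' l v' u k v f] 1 2 IH by auto
    qed
  qed
  have "\<exists>f. (\<forall>(w, p)\<in>T. ev f p = 0) \<and> (\<forall>w. w \<notin> fst ` T \<longrightarrow> f w = es ! hd w)"
    by (rule triangular_functional[OF wf]) (fact lower, fact compat)
  then obtain f where f: "\<forall>(w, p)\<in>T. ev f p = 0" "\<forall>w. w \<notin> fst ` T \<longrightarrow> f w = es ! hd w"
    by blast
  show ?thesis
  proof (rule inj_env_map_criterion[OF es])
    show "f [k] = es ! k" if "k \<le> n" for k
    proof -
      have "[k] \<notin> fst ` T"
      proof
        assume "[k] \<in> fst ` T"
        then obtain u l v where "l \<le> n" "[k] = u @ c l @ v" unfolding T_def by auto
        then show False using n(2) len_c[of l] by (auto dest!: arg_cong[of _ _ length])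
      qed
      then show ?thesis using f(2) by simp
    qed
    show "ev f (monomial u * alt_relation es k * monomial v) = 0" if "k \<le> n" for u k v
      using f(1) TI[OF that, of u v] unfolding r_def by auto
  qed
qed

end

section \<open>The derivation identity in coordinates\<close>

context n_lie_algebra
begin

lemma bracket_swap:
  assumes "length (X @ a # Y @ b # Z) = n"
  shows "bracket (X @ b # Y @ a # Z) = - bracket (X @ a # Y @ b # Z)"
proof -
  let ?\<tau> = "transpose (length X) (Suc (length X + length Y))"
  have "?\<tau> permutes {..<n}"
    using assms by (intro permutes_swap_id) auto
  then show ?thesis
    using alternating[OF assms, of ?\<tau>] by (simp add: permute_list_transpose sign_swap_id)
qed

lemma bracket_repeated:
  assumes "length zs = n" "\<not> distinct zs"
  shows "bracket zs = 0"
proof -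
  obtain X a Y Z where zs: "zs = X @ [a] @ Y @ [a] @ Z"
    using not_distinct_decomp[OF assms(2)] by blast
  then have "bracket zs = - bracket zs"
    using bracket_swap[of X a Y a Z] assms(1) by simp
  then show ?thesis using eq_uminus_self_imp_zero char_neq_2 by blast
qed

lemma bracket_move:
  assumes "length (W @ a # X @ Y) = n"
  shows "bracket (W @ a # X @ Y) = scale ((-1) ^ length X) (bracket (W @ X @ a # Y))"
  using assms
proof (induction X arbitrary: W)
  case (Cons x X)
  have "bracket (W @ a # (x # X) @ Y) = - bracket (W @ x # a # X @ Y)"
    using bracket_swap[of W x "[]" a "X @ Y"] Cons.prems by simp
  also have "bracket (W @ x # a # X @ Y) = scale ((-1) ^ length X) (bracket (W @ (x # X) @ a # Y))"
    using Cons.IH[of "W @ [x]"] Cons.prems by simp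
  finally show ?case by simp
qed simp

lemma bracket_update_expand:
  assumes "ordered_basis es" "length es = n + 1" "length zs = n" "m < n"
  shows "bracket (zs[m := y]) = (\<Sum>l\<le>n. scale (coord es y l) (bracket (zs[m := es ! l])))"
proof -
  interpret L: Vector_Spaces.linear scale scale "\<lambda>z. bracket (zs[m := z])"
    by (rule multilinear) fact+
  have "bracket (zs[m := (\<Sum>l<length es. scale (coord es y l) (es ! l))])
      = (\<Sum>l<length es. scale (coord es y l) (bracket (zs[m := es ! l])))"
    by (simp only: L.sum L.scale)
  then show ?thesis
    unfolding coord_expansion[OF assms(1)] using assms(2) by (simp add: lessThan_Suc_atMost)
qed

text \<open>
  With these signs the condition for \<open>commutator_relation\<close> is the symmetry of the coordinate matrix.
\<close>
definition signed_bracket :: "'v list \<Rightarrow> nat \<Rightarrow> 'v" where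
  "signed_bracket es k = scale ((-1) ^ k) (bracket (omit k es))"

lemma bracket_omit: "bracket (omit k es) = scale ((-1) ^ k) (signed_bracket es k)"
  unfolding signed_bracket_def by (simp flip: power_add mult_2_right)

lemma bracket_omit_update_basis:
  assumes es: "distinct es" "length es = n + 1" and ia: "i \<le> n" "a \<le> n" "a \<noteq> i" "l \<le> n"
  shows "bracket ((omit i es)[(if a < i then a else a - 1) := es ! l]) =
    (if l = a then bracket (omit i es)
     else if l = i then scale ((-1) ^ Suc (i + a)) (bracket (omit a es)) else 0)"
proof -
  let ?m = "if a < i then a else a - 1"
  have len: "length (omit i es) = n" using es ia by (simp add: length_omit)
  have m: "?m < n" using ia by auto
  have nth: "omit i es ! ?m = es ! a"
    using es ia m omit_nth[of i es ?m] by auto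
  consider "l = a" | "l = i" "a < i" | "l = i" "i < a" | "l \<noteq> a" "l \<noteq> i" using ia by linarith
  then show ?thesis
  proof cases
    case 1
    then show ?thesis using nth by (metis list_update_id)
  next
    case 2
    then have i: "i < length es" using es ia by simp
    obtain X Y Z where d: "es = X @ es ! a # Y @ es ! i # Z" "length X = a" "length Y = i - Suc a"
      using split_list_two_positions[OF 2(2) i] by blast
    have o: "omit i es = X @ es ! a # Y @ Z" "omit a es = X @ Y @ es ! i # Z"
      using omit_append[of "X @ es ! a # Y" i "es ! i" Z] omit_append[of X a "es ! a" "Y @ es ! i # Z"] 2 d
      by simp_all
    have "bracket (X @ es ! i # Y @ Z) = scale ((-1) ^ length Y) (bracket (omit a es))"
      using bracket_move[of X "es ! i" Y Z] len unfolding o by simp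
    moreover have "(-1 :: 'f) ^ length Y = (-1) ^ Suc (i + a)"
      using d(3) 2(2) by (intro minus_one_power_iff[THEN trans] minus_one_power_iff[THEN trans, symmetric]) auto
    ultimately show ?thesis
      using 2 d(2) unfolding o by (simp add: list_update_append)
  next
    case 3
    then have a: "a < length es" using es ia by simp
    obtain X Y Z where d: "es = X @ es ! i # Y @ es ! a # Z" "length X = i" "length Y = a - Suc i"
      using split_list_two_positions[OF 3(2) a] by blast
    have o: "omit a es = X @ es ! i # Y @ Z" "omit i es = X @ Y @ es ! a # Z"
      using omit_append[of "X @ es ! i # Y" a "es ! a" Z] omit_append[of X i "es ! i" "Y @ es ! a # Z"] 3 d
      by simp_all
    have "a - 1 = length (X @ Y)" using d 3 by simp
    then have u: "(omit i es)[?m := es ! l] = X @ Y @ es ! i # Z"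
      using 3 unfolding o by (simp add: list_update_append)
    have "bracket (X @ es ! i # Y @ Z) = scale ((-1) ^ length Y) (bracket (X @ Y @ es ! i # Z))"
      using bracket_move[of X "es ! i" Y Z] len unfolding o by simp
    then have "bracket (X @ Y @ es ! i # Z) = scale ((-1) ^ length Y) (bracket (omit a es))"
      unfolding o by (simp flip: power_add mult_2_right)
    moreover have "(-1 :: 'f) ^ length Y = (-1) ^ Suc (i + a)"
      using d(3) 3(2) by (auto simp: minus_one_power_iff)
    ultimately show ?thesis
      using 3 unfolding u by simp
  next
    case 4
    let ?q = "if l < i then l else l - 1"
    have q: "?q < n" "?q \<noteq> ?m" using 4 ia by auto
    have "omit i es ! ?q = es ! l"
      using es ia 4 q omit_nth[of i es ?q] by auto
    then have "((omit i es)[?m := es ! l]) ! ?q = ((omit i es)[?m := es ! l]) ! ?m"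
      using q m len by simp
    then have "\<not> distinct ((omit i es)[?m := es ! l])"
      unfolding distinct_conv_nth using q m len by (intro notI) (auto simp only: length_list_update)
    then show ?thesis using 4 len by (simp add: bracket_repeated)
  qed
qed

text \<open>
  Replacing \<open>e\<^sub>a\<close> by \<open>y\<close> in the bracket that omits \<open>e\<^sub>i\<close> leaves two terms: the \<open>e\<^sub>a\<close>-part of \<open>y\<close> gives
  the same bracket back, and the \<open>e\<^sub>i\<close>-part gives, up to sign, the bracket that omits \<open>e\<^sub>a\<close>.
\<close>
lemma signed_bracket_update:
  assumes es: "ordered_basis es" "length es = n + 1" and ia: "i \<le> n" "a \<le> n" "a \<noteq> i"
  shows "scale ((-1) ^ i) (bracket ((omit i es)[(if a < i then a else a - 1) := y])) =
    scale (coord es y a) (signed_bracket es i) - scale (coord es y i) (signed_bracket es a)"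
proof -
  let ?m = "if a < i then a else a - 1"
  have d: "distinct es" using es(1) unfolding ordered_basis_def by simp
  have len: "length (omit i es) = n" and m: "?m < n" using es ia by (auto simp: length_omit)
  have "bracket ((omit i es)[?m := y]) = (\<Sum>l\<le>n. scale (coord es y l) (bracket ((omit i es)[?m := es ! l])))"
    by (rule bracket_update_expand[OF es len m])
  also have "\<dots> = (\<Sum>l\<in>{a, i}. scale (coord es y l) (bracket ((omit i es)[?m := es ! l])))"
    using ia by (intro sum.mono_neutral_right) (auto simp: bracket_omit_update_basis[OF d es(2) ia])
  also have "\<dots> = scale (coord es y a) (bracket (omit i es))
      + scale (coord es y i) (scale ((-1) ^ Suc (i + a)) (bracket (omit a es)))"
    using ia by (simp add: bracket_omit_update_basis[OF d es(2) ia])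
  finally have eq: "bracket ((omit i es)[?m := y]) = scale (coord es y a) (bracket (omit i es))
      + scale (coord es y i) (scale ((-1) ^ Suc (i + a)) (bracket (omit a es)))" .
  have sq: "(-1) ^ i * ((-1) ^ i * c) = c" for c :: 'f
    by (cases "even i") simp_all
  show ?thesis
    unfolding eq signed_bracket_def
    by (simp add: scale_right_diff_distrib power_add mult.left_commute mult.commute sq)
qed

text \<open>
  Bracketing with all basis vectors except \<open>e\<^sub>j\<close> and \<open>e\<^sub>k\<close> is, up to sign, the derivation
  \<open>e\<^sub>j \<mapsto> \<beta>\<^sub>k\<close>, \<open>e\<^sub>k \<mapsto> -\<beta>\<^sub>j\<close> that kills the other basis vectors.
\<close>
lemma bracket_complement_of_two:
  assumes es: "ordered_basis es" "length es = n + 1" and jk: "j < k" "k \<le> n"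
  obtains ws where "length ws = n - 1"
    "\<And>l. l \<le> n \<Longrightarrow> scale ((-1) ^ (j + k)) (bracket (es ! l # ws)) =
      (if l = j then signed_bracket es k else if l = k then - signed_bracket es j else 0)"
proof -
  have d: "distinct es" using es(1) unfolding ordered_basis_def by simp
  have k: "k < length es" using es jk by simp
  obtain X Y Z where dec: "es = X @ es ! j # Y @ es ! k # Z" "length X = j" "length Y = k - Suc j"
    using split_list_two_positions[OF jk(1) k] by blast
  have o: "omit k es = X @ es ! j # Y @ Z" "omit j es = X @ Y @ es ! k # Z"
    using omit_append[of "X @ es ! j # Y" k "es ! k" Z] omit_append[of X j "es ! j" "Y @ es ! k # Z"] dec jk
    by simp_all
  have len: "length (omit k es) = n" using es jk by (simp add: length_omit)
  have 1: "bracket (es ! j # X @ Y @ Z) = scale ((-1) ^ j) (bracket (omit k es))"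
    using bracket_move[of "[]" "es ! j" X "Y @ Z"] len dec(2) unfolding o by simp
  have 2: "bracket (es ! k # X @ Y @ Z) = scale ((-1) ^ (k - 1)) (bracket (omit j es))"
    using bracket_move[of "[]" "es ! k" "X @ Y" Z] len dec(2,3) jk unfolding o by simp
  have 3: "bracket (es ! l # X @ Y @ Z) = 0" if "l \<le> n" "l \<noteq> j" "l \<noteq> k" for l
  proof -
    have "es ! l \<in> set es" using that es by simp
    moreover have "es ! l \<noteq> es ! j" "es ! l \<noteq> es ! k"
      using that d es k jk by (simp_all add: nth_eq_iff_index_eq)
    moreover have "set es = {es ! j, es ! k} \<union> set (X @ Y @ Z)"
      by (subst (1) dec(1)) auto
    ultimately have "es ! l \<in> set (X @ Y @ Z)" by blast
    then show ?thesis using len unfolding o by (intro bracket_repeated) auto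
  qed
  show ?thesis
  proof
    show "length (X @ Y @ Z) = n - 1" using len unfolding o by simp
    fix l assume l: "l \<le> n"
    have "(-1 :: 'f) ^ (k - 1) = - ((-1) ^ k)" using jk by (cases k) auto
    moreover have sq: "(-1) ^ m * ((-1) ^ m * c) = c" for c :: 'f and m
      by (cases "even m") simp_all
    ultimately show "scale ((-1) ^ (j + k)) (bracket (es ! l # X @ Y @ Z)) =
      (if l = j then signed_bracket es k else if l = k then - signed_bracket es j else 0)"
      using 1 2 3[OF l] jk
      by (auto simp: signed_bracket_def power_add mult.assoc mult.left_commute mult.commute sq)
  qed
qed

text \<open>
  Apply the derivation \<open>D\<close> of the previous lemma to the bracket that omits \<open>e\<^sub>i\<close>. Summing over its
  arguments gives \<open>D \<beta>\<^sub>i = tr(D) \<beta>\<^sub>i - (\<Sum>a. (D e\<^sub>a)\<^sub>i \<beta>\<^sub>a)\<close>, and \<open>D\<close> has only two nonzero columns.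
\<close>
lemma signed_bracket_cyclic:
  assumes es: "ordered_basis es" "length es = n + 1" and ijk: "i \<le> n" "j \<le> n" "k \<le> n"
  defines "\<beta> \<equiv> \<lambda>k j. coord es (signed_bracket es k) j"
  shows "scale (\<beta> i j - \<beta> j i) (signed_bracket es k) + scale (\<beta> j k - \<beta> k j) (signed_bracket es i)
    + scale (\<beta> k i - \<beta> i k) (signed_bracket es j) = 0"
proof -
  let ?B = "signed_bracket es"
  have less: "scale (\<beta> i j - \<beta> j i) (?B k) + scale (\<beta> j k - \<beta> k j) (?B i)
      + scale (\<beta> k i - \<beta> i k) (?B j) = 0" if jk: "j < k" "k \<le> n" for j k
  proof -
    define s :: 'f where "s = (-1) ^ (j + k)"
    obtain ws where ws: "length ws = n - 1" and ev: "\<And>l. l \<le> n \<Longrightarrow>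
        scale s (bracket (es ! l # ws)) = (if l = j then ?B k else if l = k then - ?B j else 0)"
      using bracket_complement_of_two[OF es jk] unfolding s_def by metis
    have npos: "n > 0" using jk by simp
    define D where "D y = scale s (bracket (y # ws))" for y
    have D_basis: "D (es ! l) = (if l = j then ?B k else if l = k then - ?B j else 0)" if "l \<le> n" for l
      using ev[OF that] unfolding D_def .
    interpret L: Vector_Spaces.linear scale scale "\<lambda>z. bracket (z # ws)"
      using multilinear[of "0 # ws" 0] ws npos by simp
    have D_scale: "D (scale c y) = scale c (D y)" for c y
      by (simp add: D_def L.scale mult.commute)
    have D_sum: "D (\<Sum>l\<in>A. g l) = (\<Sum>l\<in>A. D (g l))" for g and A :: "nat set"
      by (simp add: D_def L.sum scale_sum_right)
    have D_expand: "D y = scale (coord es y j) (?B k) - scale (coord es y k) (?B j)" for y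
    proof -
      have "D y = D (\<Sum>l<length es. scale (coord es y l) (es ! l))"
        unfolding coord_expansion[OF es(1)] ..
      also have "\<dots> = (\<Sum>l<length es. scale (coord es y l) (D (es ! l)))"
        by (simp only: D_sum D_scale)
      also have "\<dots> = (\<Sum>l\<in>{j, k}. scale (coord es y l) (D (es ! l)))"
        using jk es(2) by (intro sum.mono_neutral_right) (auto simp: D_basis)
      finally show ?thesis using jk by (simp add: D_basis)
    qed
    define b where "b = omit i es"
    have len: "length b = n" using es ijk(1) unfolding b_def by (simp add: length_omit)
    let ?pos = "\<lambda>a. if a < i then a else a - 1"
    have sumpos: "(\<Sum>m<n. G (if m < i then m else Suc m) m) = (\<Sum>a\<in>{..n} - {i}. G a (?pos a))" for G :: "nat \<Rightarrow> nat \<Rightarrow> 'v"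
      by (rule sum.reindex_bij_witness[of _ ?pos "\<lambda>m. if m < i then m else Suc m"]) (use ijk(1) in auto)
    have "D (?B i) = scale ((-1) ^ i) (D (bracket b))"
      unfolding signed_bracket_def b_def by (simp add: D_scale)
    also have "D (bracket b) = scale s (\<Sum>m<n. bracket (b[m := bracket (b ! m # ws)]))"
      unfolding D_def using derivation[OF len ws] by simp
    also have "\<dots> = (\<Sum>m<n. bracket (b[m := D (b ! m)]))"
    proof -
      have "scale s (bracket (b[m := z])) = bracket (b[m := scale s z])" if "m < n" for m z
      proof -
        interpret M: Vector_Spaces.linear scale scale "\<lambda>z. bracket (b[m := z])"
          by (rule multilinear[OF len that])
        show ?thesis by (simp only: M.scale)
      qed
      then show ?thesis unfolding D_def scale_sum_right by (intro sum.cong refl) simp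
    qed
    also have "\<dots> = (\<Sum>m<n. bracket (b[m := D (es ! (if m < i then m else Suc m))]))"
      unfolding b_def using es(2) ijk(1) by (intro sum.cong refl) (simp add: omit_nth)
    also have "\<dots> = (\<Sum>a\<in>{..n} - {i}. bracket (b[?pos a := D (es ! a)]))"
      by (rule sumpos[of "\<lambda>a m. bracket (b[m := D (es ! a)])"])
    also have "scale ((-1) ^ i) \<dots> = (\<Sum>a\<in>{..n} - {i}.
        scale (coord es (D (es ! a)) a) (?B i) - scale (coord es (D (es ! a)) i) (?B a))"
      unfolding scale_sum_right b_def
      by (intro sum.cong refl signed_bracket_update[OF es ijk(1)]) auto
    \<comment> \<open>The two parts of the summand for \<open>a = i\<close> cancel, so this index may be included.\<close>
    also have "\<dots> = (\<Sum>a\<le>n.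
        scale (coord es (D (es ! a)) a) (?B i) - scale (coord es (D (es ! a)) i) (?B a))"
      by (rule sum.mono_neutral_left) auto
    also have "\<dots> = (\<Sum>a\<in>{j, k}.
        scale (coord es (D (es ! a)) a) (?B i) - scale (coord es (D (es ! a)) i) (?B a))"
      using jk by (intro sum.mono_neutral_right) (auto simp: D_basis representation_zero)
    also have "\<dots> = scale (\<beta> k j) (?B i) - scale (\<beta> k i) (?B j)
        - scale (\<beta> j k) (?B i) + scale (\<beta> j i) (?B k)"
      using jk es(1) unfolding \<beta>_def ordered_basis_def
      by (simp add: D_basis representation_neg algebra_simps)
    finally show ?thesis
      unfolding D_expand \<beta>_def by (simp add: scale_left_diff_distrib algebra_simps)
  qed
  consider "j < k" | "j = k" | "k < j" by linarith
  then show ?thesis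
  proof cases
    case 1
    then show ?thesis using less[of j k] ijk by simp
  next
    case 2
    then show ?thesis by (simp add: scale_left_diff_distrib)
  next
    case 3
    then show ?thesis
      using less[of k j] ijk by (simp add: scale_left_diff_distrib algebra_simps)
  qed
qed

end

section \<open>Non-symmetric structure constants\<close>

text \<open>
  Product of linear forms evaluated at the letters of a word: the form used at a letter is determined
  modulo \<open>m\<close> by the number of letters to its right, where \<open>d\<close> letters are imagined to follow the word.
\<close>
fun cyclic_weight :: "(nat \<Rightarrow> nat \<Rightarrow> 'f::field) \<Rightarrow> nat \<Rightarrow> nat \<Rightarrow> nat list \<Rightarrow> 'f" where
  "cyclic_weight h m d [] = 1"
| "cyclic_weight h m d (k # w) = h ((length w + d) mod m) k * cyclic_weight h m d w"

lemma cyclic_weight_append: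
  "cyclic_weight h m d (xs @ ys) = cyclic_weight h m (d + length ys) xs * cyclic_weight h m d ys"
  by (induction xs) (simp_all add: add_ac mult.assoc)

lemma cyclic_weight_period: "cyclic_weight h m (d + m) w = cyclic_weight h m d w"
  by (induction w) (simp_all add: add.assoc[symmetric])

definition others :: "nat \<Rightarrow> nat \<Rightarrow> nat \<Rightarrow> nat list" where
  "others n p q = filter (\<lambda>k. k \<noteq> p \<and> k \<noteq> q) [0..<n + 1]"

lemma set_others: "set (others n p q) = {..n} - {p, q}"
  unfolding others_def by auto

lemma distinct_others: "distinct (others n p q)"
  unfolding others_def by (intro distinct_filter distinct_upt)

lemma length_others:
  assumes "p \<le> n" "q \<le> n" "p \<noteq> q"
  shows "length (others n p q) = n - 1"
  using assms by (simp add: distinct_card[OF distinct_others, symmetric] set_others card_Diff_subset)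

lemma others_commute: "others n p q = others n q p"
  unfolding others_def by (rule filter_cong) auto

text \<open>
  Values on basis vectors of the linear forms \<open>e\<^sup>k - u k e\<^sup>p - v k e\<^sup>q\<close>, \<open>k \<noteq> p, q\<close>. If \<open>u\<close> has the
  coordinates \<open>1, 0\<close> at \<open>p, q\<close> and \<open>v\<close> has \<open>0, 1\<close>, their common kernel is the plane spanned by the
  vectors \<open>u\<close> and \<open>v\<close>.
\<close>
definition transversal :: "nat \<Rightarrow> nat \<Rightarrow> nat \<Rightarrow> (nat \<Rightarrow> 'f::field) \<Rightarrow> (nat \<Rightarrow> 'f) \<Rightarrow> nat \<Rightarrow> nat \<Rightarrow> 'f" where
  "transversal n p q u v i j =
     (let k = others n p q ! i in if j = p then - u k else if j = q then - v k else if j = k then 1 else 0)"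

lemma transversal_commute:
  assumes "p \<noteq> q"
  shows "transversal n p q u v = transversal n q p v u"
  using assms by (intro ext) (auto simp: transversal_def Let_def others_commute[of n p q])

lemma sum_transversal:
  assumes pq: "p \<le> n" "q \<le> n" "p \<noteq> q" and i: "i < n - 1"
  shows "(\<Sum>j\<le>n. x j * transversal n p q u v i j) =
    x (others n p q ! i) - u (others n p q ! i) * x p - v (others n p q ! i) * x q"
proof -
  let ?k = "others n p q ! i"
  have "?k \<in> set (others n p q)" using i length_others[OF pq] by (intro nth_mem) simp
  then have k: "?k \<le> n" "?k \<noteq> p" "?k \<noteq> q" unfolding set_others by auto
  have "(\<Sum>j\<le>n. x j * transversal n p q u v i j) = (\<Sum>j\<in>{p, q, ?k}. x j * transversal n p q u v i j)"
    using pq k by (intro sum.mono_neutral_right) (auto simp: transversal_def Let_def)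
  then show ?thesis using pq k by (simp add: transversal_def Let_def algebra_simps)
qed

lemma cyclic_weight_transversal:
  assumes "length ws \<le> length (others n p q)" "length ws \<le> m" "p \<notin> set ws" "q \<notin> set ws"
  shows "cyclic_weight (transversal n p q u v) m 0 ws =
    (if ws = rev (take (length ws) (others n p q)) then 1 else 0)"
  using assms
proof (induction ws)
  case (Cons k ws)
  then have l: "length ws < length (others n p q)" "length ws < m" by simp_all
  have "transversal n p q u v (length ws) k = (if k = others n p q ! length ws then 1 else 0)"
    using Cons.prems by (auto simp: transversal_def Let_def)
  then show ?case using Cons l by (simp add: take_Suc_conv_app_nth)
qed simp

lemma vector_space_field: "vector_space ((*) :: 'f::field \<Rightarrow> 'f \<Rightarrow> 'f)"
  by unfold_locales (simp_all add: algebra_simps)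

text \<open>
  Up to a sign common to all \<open>k\<close>, this is the maximal minor that omits column \<open>k\<close>, taken with the
  sign \<open>(-1)\<^sup>k\<close>, of the matrix with the \<open>n\<close> rows \<open>h 0, \<dots>, h (n - 2), e\<^sup>q\<close> and \<open>n + 1\<close> columns.
\<close>
definition minor_weight :: "(nat \<Rightarrow> nat \<Rightarrow> 'f::field) \<Rightarrow> nat \<Rightarrow> nat \<Rightarrow> nat \<Rightarrow> 'f" where
  "minor_weight h n q k = (-1) ^ k * lin_ext (*) (\<lambda>w. cyclic_weight h (n - 1) 0 (butlast w) * (if last w = q then 1 else 0))
     (alt (map var (omit k [0..<n + 1])))"

text \<open>
  The vector of maximal minors is annihilated by each of the forms, since expanding a determinant
  with a repeated row gives zero.
\<close>
lemma minor_weight_annihilated: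
  fixes h :: "nat \<Rightarrow> nat \<Rightarrow> 'f::field"
  assumes char: "CHAR('f) \<noteq> 2" and n: "n \<ge> 2" and q: "q \<le> n"
  shows "i < n - 1 \<Longrightarrow> (\<Sum>k\<le>n. minor_weight h n q k * h i k) = 0"
    and "minor_weight h n q q = 0"
proof -
  interpret F: vector_space "(*) :: 'f \<Rightarrow> 'f \<Rightarrow> 'f" by (rule vector_space_field)
  let ?cw = "cyclic_weight h (n - 1)"
  let ?g = "\<lambda>w. ?cw 0 (butlast w) * (if last w = q then 1 else 0)"
  have expand: "lin_ext (*) (\<lambda>w. f (hd w) * ?g (tl w)) (alt (map var [0..<n + 1]))
      = (\<Sum>k\<le>n. minor_weight h n q k * f k)" for f
  proof -
    have len: "length (map var [0..<n + 1] :: (nat word \<Rightarrow>\<^sub>0 'f) list) = Suc n" by simp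
    have c: "(-1) ^ k = (const ((-1) ^ k) :: nat word \<Rightarrow>\<^sub>0 'f)" for k
      using of_int_eq_const[of "(-1) ^ k", where 'a = 'f] by simp
    have "lin_ext (*) (\<lambda>w. f (hd w) * ?g (tl w)) (alt (map var [0..<n + 1]))
      = (\<Sum>k\<le>n. (-1) ^ k * lin_ext (*) (\<lambda>w. f (hd w) * ?g (tl w)) (monomial [k] * alt (map var (omit k [0..<n + 1])) * monomial []))"
      unfolding alt_expand_first[OF len] F.lin_ext_sum c F.lin_ext_const_mult
      by (intro sum.cong refl) (simp add: map_omit monomial_Nil var_def[symmetric] del: upt_Suc)
    also have "\<dots> = (\<Sum>k\<le>n. minor_weight h n q k * f k)"
    proof (intro sum.cong refl)
      fix k
      have "lin_ext (*) (\<lambda>w. f (hd w) * ?g (tl w)) (monomial [k] * alt (map var (omit k [0..<n + 1])) * monomial [])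
        = lin_ext (*) (\<lambda>w. f k * ?g w) (alt (map var (omit k [0..<n + 1])))"
        unfolding F.lin_ext_shift_context by simp
      also have "\<dots> = f k * lin_ext (*) ?g (alt (map var (omit k [0..<n + 1])))"
        unfolding lin_ext_def sum_distrib_left by (intro sum.cong refl) (rule mult.left_commute)
      finally show "(-1) ^ k * lin_ext (*) (\<lambda>w. f (hd w) * ?g (tl w)) (monomial [k] * alt (map var (omit k [0..<n + 1])) * monomial [])
          = minor_weight h n q k * f k"
        by (simp only: minor_weight_def mult_ac)
    qed
    finally show ?thesis .
  qed
  show "(\<Sum>k\<le>n. minor_weight h n q k * h i k) = 0" if i: "i < n - 1"
    unfolding expand[symmetric]
  proof (rule F.lin_ext_alt_vars_zero[OF char, where i = 0 and d = "n - 2 - i"])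
    fix X Y Z :: "nat list" and a b
    assume X: "length X = 0" and Y: "length Y = n - 2 - i" and L: "length (X @ a # Y @ b # Z) = length [0..<n + 1]"
    then have "length Z = Suc i" using i by simp
    then obtain Z' l where Z: "Z = Z' @ [l]" "length Z' = i" by (metis length_Suc_conv_rev)
    have gc: "?g (Y @ c # Z) = ?cw (Suc i) Y * h i c * ?cw 0 Z' * (if l = q then 1 else 0)" for c
      using i Z(2) unfolding Z(1) by (simp add: butlast_append cyclic_weight_append)
    have "X = []" using X by simp
    then show "h i (hd (X @ a # Y @ b # Z)) * ?g (tl (X @ a # Y @ b # Z))
      = h i (hd (X @ b # Y @ a # Z)) * ?g (tl (X @ b # Y @ a # Z))"
      by (simp only: append_Nil list.sel gc) (simp only: mult_ac)
  qed (use i in simp)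
  have "(\<Sum>k\<le>n. minor_weight h n q k * (if k = q then 1 else 0)) = 0"
    unfolding expand[symmetric]
  proof (rule F.lin_ext_alt_vars_zero[OF char, where i = 0 and d = "n - 1"])
    fix X Y Z :: "nat list" and a b
    assume "length X = 0" "length Y = n - 1" "length (X @ a # Y @ b # Z) = length [0..<n + 1]"
    then have "X = []" "Z = []" using n by simp_all
    then show "(if hd (X @ a # Y @ b # Z) = q then 1 else 0) * ?g (tl (X @ a # Y @ b # Z))
      = (if hd (X @ b # Y @ a # Z) = q then 1 else 0) * ?g (tl (X @ b # Y @ a # Z))"
      by simp
  qed (use n in simp)
  moreover have "(\<Sum>k\<le>n. minor_weight h n q k * (if k = q then 1 else 0)) = minor_weight h n q q"
    using q by (simp add: if_distrib[of "\<lambda>x. _ * x"] cong: if_cong)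
  ultimately show "minor_weight h n q q = 0" by simp
qed

text \<open>
  Only one permutation contributes: the last letter must be \<open>q\<close>, so that \<open>p\<close> and \<open>q\<close> do not
  occur among the other letters, on which the forms are those of the dual basis.
\<close>
lemma minor_weight_nonzero:
  fixes u v :: "nat \<Rightarrow> 'f::field"
  assumes pq: "p \<le> n" "q \<le> n" "p \<noteq> q"
  shows "minor_weight (transversal n p q u v) n q p \<noteq> 0"
proof -
  interpret F: vector_space "(*) :: 'f \<Rightarrow> 'f \<Rightarrow> 'f" by (rule vector_space_field)
  let ?c = "omit p [0..<n + 1]" and ?w = "rev (others n p q) @ [q]"
  let ?P = "{\<sigma>. \<sigma> permutes {..<length ?c}}"
  let ?g = "\<lambda>w. cyclic_weight (transversal n p q u v) (n - 1) 0 (butlast w) * (if last w = q then 1 else 0)"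
  have dc: "distinct ?c" using sorted_omit_upt strict_sorted_iff by blast
  have sc: "set ?c = {..n} - {p}" unfolding set_omit_upt by auto
  have lc: "length ?c = n" using pq by (simp add: length_omit)
  have "set ?w = set ?c" "distinct ?w"
    using pq distinct_others[of n p q] unfolding sc by (auto simp: set_others)
  then have "mset ?w = mset ?c" using dc by (metis set_eq_iff_mset_eq_distinct)
  then obtain \<tau> where \<tau>: "\<tau> permutes {..<length ?c}" "permute_list \<tau> ?c = ?w"
    by (rule mset_eq_permutation)
  have g: "?g (permute_list \<sigma> ?c) = (if \<sigma> = \<tau> then 1 else 0)" if \<sigma>: "\<sigma> permutes {..<length ?c}" for \<sigma>
  proof -
    let ?x = "permute_list \<sigma> ?c"
    have x: "length ?x = n" "distinct ?x" "set ?x = {..n} - {p}"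
      using \<sigma> dc sc lc by simp_all
    have "n \<noteq> 0" using pq by auto
    then have ne: "?x \<noteq> []" using x(1) by (metis list.size(3))
    have bl: "?x = butlast ?x @ [last ?x]" using ne by simp
    show ?thesis
    proof (cases "last ?x = q")
      case True
      have d: "distinct (butlast ?x @ [q])" using bl x(2) True by metis
      have "p \<notin> set (butlast ?x)" using x(3) in_set_butlastD by fastforce
      moreover have "q \<notin> set (butlast ?x)" using d by simp
      moreover have "length (butlast ?x) = length (others n p q)" "length (butlast ?x) = n - 1"
        using x(1) length_others[OF pq] by simp_all
      ultimately have "?g ?x = (if butlast ?x = rev (others n p q) then 1 else 0)"
        using True by (simp add: cyclic_weight_transversal)
      also have "butlast ?x = rev (others n p q) \<longleftrightarrow> ?x = ?w"
        using bl True by (metis butlast_snoc)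
      also have "\<dots> \<longleftrightarrow> \<sigma> = \<tau>"
        using \<tau> permute_list_inj[OF dc \<sigma> \<tau>(1)] by metis
      finally show ?thesis .
    next
      case False
      then have "\<sigma> \<noteq> \<tau>" using \<tau>(2) by force
      then show ?thesis using False by simp
    qed
  qed
  have "lin_ext (*) ?g (alt (map var ?c)) = (\<Sum>\<sigma>\<in>?P. if \<sigma> = \<tau> then of_int (sign \<sigma>) else 0)"
    unfolding F.lin_ext_alt_vars
  proof (intro sum.cong refl)
    fix \<sigma> assume "\<sigma> \<in> ?P"
    then have \<sigma>: "\<sigma> permutes {..<length ?c}" by simp
    show "of_int (sign \<sigma>) * ?g (permute_list \<sigma> ?c) = (if \<sigma> = \<tau> then of_int (sign \<sigma>) else 0)"
      unfolding g[OF \<sigma>] by (cases "\<sigma> = \<tau>") simp_all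
  qed
  also have "\<dots> = of_int (sign \<tau>)"
    using \<tau>(1) by (simp add: finite_permutations)
  finally show ?thesis
    unfolding minor_weight_def by (simp add: sign_def)
qed

text \<open>
  The common zeros of the transversal forms are the combinations of \<open>u\<close> and \<open>v\<close>, and the coefficient
  of \<open>v\<close> is the entry at \<open>q\<close>, which is zero.
\<close>
lemma minor_weight_transversal:
  fixes u v :: "nat \<Rightarrow> 'f::field"
  assumes char: "CHAR('f) \<noteq> 2" and n: "n \<ge> 2" and pq: "p \<le> n" "q \<le> n" "p \<noteq> q"
    and uv: "u p = 1" "u q = 0" "v p = 0" "v q = 1" and k: "k \<le> n"
  defines "h \<equiv> transversal n p q u v"
  shows "minor_weight h n q k = minor_weight h n q p * u k"
proof -
  consider "k = p" | "k = q" | "k \<in> set (others n p q)" using k unfolding set_others by auto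
  then show ?thesis
  proof cases
    case 3
    then obtain i where i: "i < n - 1" "others n p q ! i = k"
      using length_others[OF pq] by (metis in_set_conv_nth)
    have "minor_weight h n q k - u k * minor_weight h n q p - v k * minor_weight h n q q = 0"
      using minor_weight_annihilated(1)[OF char n pq(2) i(1), of h] sum_transversal[OF pq i(1)] i(2)
      unfolding h_def by metis
    then show ?thesis
      using minor_weight_annihilated(2)[OF char n pq(2), of h] by (simp add: mult.commute)
  qed (use uv minor_weight_annihilated(2)[OF char n pq(2), of h] in simp_all)
qed

context n_lie_algebra
begin

text \<open>
  The vectors \<open>u\<close> and \<open>v\<close> are column \<open>q\<close> and row \<open>p\<close> of the skew part \<open>A\<close>, divided by \<open>A p q\<close>. The
  cyclic identity for \<open>p, q, r\<close> expresses row \<open>r\<close> of \<open>\<beta>\<close> by the rows \<open>p\<close> and \<open>q\<close>. For \<open>r, s, p\<close> and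
  \<open>r, s, q\<close> it then shows that \<open>A\<close> is \<open>A p q\<close> times the wedge product of \<open>u\<close> and \<open>v\<close>, which carries
  the statement about rows over to columns: every bracket lies in the plane spanned by \<open>u\<close> and \<open>v\<close>.
\<close>
lemma nonsymmetric_structure:
  assumes es: "ordered_basis es" "length es = n + 1"
    and pq: "p \<le> n" "q \<le> n"
      "coord es (signed_bracket es p) q \<noteq> coord es (signed_bracket es q) p"
  obtains u v where "u p = 1" "u q = 0" "v p = 0" "v q = 1"
    "\<And>r. r \<le> n \<Longrightarrow> signed_bracket es r =
       scale (u r) (signed_bracket es p) + scale (v r) (signed_bracket es q)"
    "\<And>r k. r \<le> n \<Longrightarrow> k \<le> n \<Longrightarrow> coord es (signed_bracket es r) k =
       u k * coord es (signed_bracket es r) p + v k * coord es (signed_bracket es r) q"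
proof -
  define B where "B = signed_bracket es"
  define \<beta> where "\<beta> k j = coord es (B k) j" for k j
  define A where "A i j = \<beta> i j - \<beta> j i" for i j
  have skew: "A i j = - A j i" for i j unfolding A_def by simp
  have cyc: "scale (A i j) (B k) + scale (A j k) (B i) + scale (A k i) (B j) = 0"
    if "i \<le> n" "j \<le> n" "k \<le> n" for i j k
    using signed_bracket_cyclic[OF es that] unfolding A_def \<beta>_def B_def .
  have Apq: "A p q \<noteq> 0" using pq(3) unfolding A_def \<beta>_def B_def by simp
  define u where "u k = A k q / A p q" for k
  define v where "v k = A p k / A p q" for k
  have uv: "u p = 1" "u q = 0" "v p = 0" "v q = 1"
    using Apq by (simp_all add: u_def v_def A_def)
  have Au: "A k q = A p q * u k" and Av: "A p k = A p q * v k" for k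
    using Apq by (simp_all add: u_def v_def)
  have rank2: "B r = scale (u r) (B p) + scale (v r) (B q)" if r: "r \<le> n" for r
  proof -
    have "scale (A p q) (B r) = (scale (A p q) (B r) + scale (A q r) (B p) + scale (A r p) (B q))
        + (scale (A r q) (B p) + scale (A p r) (B q))"
      unfolding skew[of q r] skew[of r p] by (simp add: algebra_simps)
    also have "\<dots> = scale (A r q) (B p) + scale (A p r) (B q)"
      unfolding cyc[OF pq(1,2) r] by simp
    also have "\<dots> = scale (A p q) (scale (u r) (B p) + scale (v r) (B q))"
      unfolding Au[of r] Av[of r] by (simp add: scale_right_distrib)
    finally show ?thesis using Apq by (metis scale_cancel_left)
  qed
  have A: "A r s = A p q * (u r * v s - u s * v r)" if r: "r \<le> n" and s: "s \<le> n" for r s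
  proof -
    define c where "c = A p q * (u r * v s - u s * v r)"
    have "scale (A r s) (B p) = (scale (A r s) (B p) + scale (A s p) (B r) + scale (A p r) (B s))
        - scale (A s p) (B r) - scale (A p r) (B s)" by simp
    also have "\<dots> = scale (A p q) (scale (v s) (B r) - scale (v r) (B s))"
      unfolding cyc[OF r s pq(1)] unfolding skew[of s p] Av[of s] Av[of r]
      by (simp add: scale_right_diff_distrib)
    also have "\<dots> = scale c (B p)"
      unfolding rank2[OF r] rank2[OF s] c_def
      by (simp add: scale_right_diff_distrib scale_right_distrib scale_left_diff_distrib algebra_simps)
    finally have 1: "scale (A r s - c) (B p) = 0" by (simp add: scale_left_diff_distrib)
    have "scale (A r s) (B q) = (scale (A r s) (B q) + scale (A s q) (B r) + scale (A q r) (B s))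
        - scale (A s q) (B r) - scale (A q r) (B s)" by simp
    also have "\<dots> = scale (A p q) (scale (u r) (B s) - scale (u s) (B r))"
      unfolding cyc[OF r s pq(2)] unfolding skew[of q r] Au[of s] Au[of r]
      by (simp add: scale_right_diff_distrib)
    also have "\<dots> = scale c (B q)"
      unfolding rank2[OF r] rank2[OF s] c_def
      by (simp add: scale_right_diff_distrib scale_right_distrib scale_left_diff_distrib algebra_simps)
    finally have 2: "scale (A r s - c) (B q) = 0" by (simp add: scale_left_diff_distrib)
    have "B p \<noteq> 0 \<or> B q \<noteq> 0"
      using Apq unfolding A_def \<beta>_def by (auto simp: representation_zero)
    then show ?thesis using 1 2 unfolding c_def by auto
  qed
  have rows: "\<beta> r k = u k * \<beta> r p + v k * \<beta> r q" if r: "r \<le> n" and k: "k \<le> n" for r k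
  proof -
    have ob: "independent (set es)" "span (set es) = UNIV" using es(1) unfolding ordered_basis_def by auto
    have col: "\<beta> k r = u k * \<beta> p r + v k * \<beta> q r"
      unfolding \<beta>_def by (subst rank2[OF k]) (simp add: ob representation_add representation_scale)
    have "\<beta> r k = \<beta> k r + A r k" "\<beta> p r = \<beta> r p - A r p" "\<beta> q r = \<beta> r q - A r q"
      unfolding A_def by simp_all
    then show ?thesis
      using A[OF r k] A[OF r pq(1)] A[OF r pq(2)] unfolding uv col
      by (simp add: algebra_simps)
  qed
  show ?thesis
    using that[OF uv] rank2 rows unfolding \<beta>_def B_def by blast
qed

text \<open>
  The function \<open>f\<close> described at the beginning, for the transversal forms. The operator \<open>T\<close> only
  depends on the coordinates at \<open>p\<close> and \<open>q\<close>; it is normalised by two minors so that the alternating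
  sum over a block at the end of a word is the bracket (\<open>block\<close>).
\<close>
lemma inj_env_map_if_nonsymmetric:
  assumes es: "ordered_basis es" "length es = n + 1" and n: "n \<ge> 2"
    and pq: "p \<le> n" "q \<le> n"
      "coord es (signed_bracket es p) q \<noteq> coord es (signed_bracket es q) p"
  shows "inj (env_map es)"
proof -
  let ?B = "signed_bracket es"
  have pq': "p \<noteq> q" using pq(3) by auto
  obtain u v where uv: "u p = 1" "u q = 0" "v p = 0" "v q = 1"
    and rank2: "\<And>r. r \<le> n \<Longrightarrow> ?B r = scale (u r) (?B p) + scale (v r) (?B q)"
    and rows: "\<And>r k. r \<le> n \<Longrightarrow> k \<le> n \<Longrightarrow>
       coord es (?B r) k = u k * coord es (?B r) p + v k * coord es (?B r) q"
    using nonsymmetric_structure[OF es pq] by metis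
  define h where "h = transversal n p q u v"
  have h': "h = transversal n q p v u"
    unfolding h_def by (rule transversal_commute[OF pq'])
  define m where "m = n - 1"
  have m: "m > 0" "n = Suc m" using n unfolding m_def by auto
  let ?cw = "cyclic_weight h m"
  define a where "a = minor_weight h n q p"
  define b where "b = minor_weight h n p q"
  have ab: "a \<noteq> 0" "b \<noteq> 0"
    using minor_weight_nonzero[OF pq(1,2) pq', of u v] minor_weight_nonzero[OF pq(2,1) pq'[symmetric], of v u]
    unfolding a_def b_def h_def[symmetric] h'[symmetric] by auto
  have mw: "minor_weight h n q k = a * u k" "minor_weight h n p k = b * v k" if "k \<le> n" for k
    using minor_weight_transversal[OF char_neq_2 n pq(1,2) pq' uv that]
      minor_weight_transversal[OF char_neq_2 n pq(2,1) pq'[symmetric] uv(4,3,2,1) that]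
    unfolding a_def b_def h_def[symmetric] h'[symmetric] by auto
  have hB: "(\<Sum>j\<le>n. coord es (bracket (omit k es)) j * h i j) = 0" if k: "k \<le> n" and i: "i < m" for k i
  proof -
    have oi: "others n p q ! i \<le> n"
      using nth_mem[of i "others n p q"] length_others[OF pq(1,2) pq'] i
      unfolding m_def set_others by simp
    have ob: "independent (set es)" "span (set es) = UNIV" using es(1) unfolding ordered_basis_def by auto
    have "(\<Sum>j\<le>n. coord es (?B k) j * h i j) = 0"
      using sum_transversal[OF pq(1,2) pq', of i "coord es (?B k)" u v] i rows[OF k oi]
      unfolding h_def m_def by simp
    moreover have "coord es (bracket (omit k es)) j = (-1) ^ k * coord es (?B k) j" for j
      unfolding bracket_omit using ob by (simp add: representation_scale)
    ultimately show ?thesis by (simp add: mult.assoc sum_distrib_left[symmetric])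
  qed
  define T where "T y = scale (coord es y q / a) (?B p) + scale (coord es y p / b) (?B q)" for y
  have ob: "independent (set es)" "span (set es) = UNIV" using es(1) unfolding ordered_basis_def by auto
  have T_add: "T (x + y) = T x + T y" and T_scale: "T (scale c x) = scale c (T x)" for x y c
    unfolding T_def using ob
    by (simp_all add: representation_add representation_scale add_divide_distrib scale_left_distrib
        scale_right_distrib algebra_simps)
  have Tn_add: "(T ^^ t) (x + y) = (T ^^ t) x + (T ^^ t) y"
    and Tn_scale: "(T ^^ t) (scale c x) = scale c ((T ^^ t) x)" for t x y c
    by (induction t) (simp_all add: T_add T_scale)
  define G where "G w = scale (?cw 0 (butlast w)) (T (es ! last w))" for w
  have block: "ev G (alt (map var (omit k [0..<n + 1]))) = bracket (omit k es)" if k: "k \<le> n" for k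
  proof -
    let ?c = "omit k [0..<n + 1]" and ?P = "{\<sigma>. \<sigma> permutes {..<length (omit k [0..<n + 1])}}"
    interpret F: vector_space "(*) :: 'f \<Rightarrow> 'f \<Rightarrow> 'f" by (rule vector_space_field)
    let ?g = "\<lambda>x w. ?cw 0 (butlast w) * (if last w = x then 1 else 0)"
    let ?s = "\<lambda>x. \<Sum>\<sigma>\<in>?P. of_int (sign \<sigma>) * ?g x (permute_list \<sigma> ?c)"
    have s: "?s x = (-1) ^ k * minor_weight h n x k" for x
      unfolding minor_weight_def F.lin_ext_alt_vars m_def[symmetric] by (cases "even k") simp_all
    have "G w = scale (?g q w / a) (?B p) + scale (?g p w / b) (?B q)" if "last w \<le> n" for w
      unfolding G_def T_def using that pq es(2) by (simp add: coord_basis[OF es(1)] scale_right_distrib)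
    moreover have "last (permute_list \<sigma> ?c) \<le> n" if "\<sigma> \<in> ?P" for \<sigma>
    proof -
      have "length (permute_list \<sigma> ?c) = n" using k by (simp add: length_omit)
      then have "permute_list \<sigma> ?c \<noteq> []" using n by (metis list.size(3) not_numeral_le_zero)
      then have "last (permute_list \<sigma> ?c) \<in> set ?c" using that by (metis last_in_set mem_Collect_eq set_permute_list)
      then show ?thesis unfolding set_omit_upt by simp
    qed
    ultimately have "ev G (alt (map var ?c)) = (\<Sum>\<sigma>\<in>?P. scale (of_int (sign \<sigma>))
        (scale (?g q (permute_list \<sigma> ?c) / a) (?B p) + scale (?g p (permute_list \<sigma> ?c) / b) (?B q)))"
      unfolding lin_ext_alt_vars by (intro sum.cong refl) metis
    also have "\<dots> = scale (?s q / a) (?B p) + scale (?s p / b) (?B q)"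
      by (simp only: scale_right_distrib sum.distrib scale_scale times_divide_eq_right
          scale_sum_left[symmetric] sum_divide_distrib[symmetric])
    also have "\<dots> = scale ((-1) ^ k) (scale (u k) (?B p) + scale (v k) (?B q))"
      unfolding s mw[OF k] using ab by (simp add: scale_right_distrib)
    also have "\<dots> = bracket (omit k es)"
      unfolding rank2[OF k, symmetric] bracket_omit ..
    finally show ?thesis .
  qed
  define f where "f w = scale (?cw 0 (butlast w)) ((T ^^ ((length w - 1) div m)) (es ! last w))" for w
  have idx: "{..<length es} = {..n}" using es(2) by auto
  show ?thesis
  proof (rule inj_env_map_criterion[OF es])
    show "f [k] = es ! k" if "k \<le> n" for k
      unfolding f_def by simp
    show "ev f (monomial w * alt_relation es k * monomial w') = 0" if k: "k \<le> n" for w k w'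
    proof (cases w' rule: rev_cases)
      case Nil
      define L where "L y = scale (?cw 0 w) ((T ^^ (length w div m)) y)" for y
      have L: "L (x + y) = L x + L y" "L (scale c x) = scale c (L x)" for x y c
        unfolding L_def by (simp_all add: Tn_add Tn_scale scale_right_distrib mult.commute)
      have word: "f (w @ x) = L (G x)" if lx: "length x = n" for x
      proof -
        obtain y l where x: "x = y @ [l]" using lx m(2) by (cases x rule: rev_cases) auto
        then have y: "length y = m" using lx m(2) by simp
        have "(T ^^ ((length w + m) div m)) z = (T ^^ (length w div m)) (T z)" for z
          using m(1) by (simp add: funpow_swap1)
        then show ?thesis
          using cyclic_weight_period[of h m 0 w] unfolding f_def L_def G_def x
          by (simp add: butlast_append cyclic_weight_append y Tn_scale)
      qed
      have "ev (\<lambda>x. f (w @ x @ [])) (alt (map var (omit k [0..<n + 1])))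
          = ev (\<lambda>x. L (G x)) (alt (map var (omit k [0..<n + 1])))"
        unfolding lin_ext_alt_vars using k by (intro sum.cong refl) (simp add: word length_omit)
      also have "\<dots> = L (bracket (omit k es))"
        unfolding block[OF k, symmetric] by (rule lin_ext_comp) (fact L)+
      moreover have "ev (\<lambda>x. f (w @ x @ [])) (phi es (bracket (omit k es))) = L (bracket (omit k es))"
      proof -
        have "ev (\<lambda>x. f (w @ x @ [])) (phi es (bracket (omit k es)))
            = ev (\<lambda>x. L (es ! last x)) (phi es (bracket (omit k es)))"
          unfolding ev_phi f_def L_def by (simp add: butlast_append)
        also have "\<dots> = L (ev (\<lambda>x. es ! last x) (phi es (bracket (omit k es))))"
          by (rule lin_ext_comp) (fact L)+
        also have "ev (\<lambda>x. es ! last x) (phi es (bracket (omit k es))) = bracket (omit k es)"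
          unfolding ev_phi using coord_expansion[OF es(1)] by simp
        finally show ?thesis .
      qed
      ultimately show ?thesis
        unfolding alt_relation_def lin_ext_shift_context lin_ext_diff Nil by simp
    next
      case (snoc z l)
      let ?i = "length z mod m"
      have i: "?i < m" using m(1) by simp
      have "ev (\<lambda>x. f (w @ x @ w')) (alt (map var (omit k [0..<n + 1]))) = 0"
      proof (rule lin_ext_alt_vars_zero[OF char_neq_2, where i = 0 and d = "n - 2"])
        fix X Y Z :: "nat list" and c d
        assume "length X = 0" "length Y = n - 2"
          and "length (X @ c # Y @ d # Z) = length (omit k [0..<n + 1])"
        then have XZ: "X = []" "Z = []" and Y: "Suc (length Y) = m"
          using n k m by (simp_all add: length_omit)
        \<comment> \<open>The first and the last letter of the block are \<open>n - 1\<close> places apart, one full cycle.\<close>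
        have "?cw 0 (w @ c # Y @ d # z) = ?cw (Suc (Suc (length Y + length z))) w * (h ?i c * h ?i d) * ?cw (Suc (length z)) Y * ?cw 0 z" for c d
        proof -
          have "(length Y + (length z + 1)) mod m = ?i"
            using Y by (metis add.assoc add.commute mod_add_self2 plus_1_eq_Suc)
          then show ?thesis
            using Y by (simp add: cyclic_weight_append ac_simps)
        qed
        then have "?cw 0 (w @ c # Y @ d # z) = ?cw 0 (w @ d # Y @ c # z)"
          by (simp only: mult.commute[of "h ?i c"])
        then show "f (w @ (X @ c # Y @ d # Z) @ w') = f (w @ (X @ d # Y @ c # Z) @ w')"
          unfolding f_def snoc XZ by (simp add: butlast_append)
      qed (use n k in \<open>simp add: length_omit\<close>)
      moreover have "ev (\<lambda>x. f (w @ x @ w')) (phi es (bracket (omit k es))) = 0"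
      proof -
        define y where "y = scale (?cw (Suc (length z)) w * ?cw 0 z)
          ((T ^^ ((length w + Suc (length z)) div m)) (es ! l))"
        have "f (w @ [j] @ w') = scale (h ?i j) y" for j
          unfolding f_def y_def snoc by (simp add: butlast_append cyclic_weight_append ac_simps)
        then have "ev (\<lambda>x. f (w @ x @ w')) (phi es (bracket (omit k es)))
            = scale (\<Sum>j\<le>n. coord es (bracket (omit k es)) j * h ?i j) y"
          unfolding ev_phi idx by (simp add: scale_sum_left)
        then show ?thesis using hB[OF k i] by simp
      qed
      ultimately show ?thesis
        unfolding alt_relation_def lin_ext_shift_context lin_ext_diff by simp
    qed
  qed
qed

end

section \<open>Injectivity of the natural map\<close>

theorem corollary5p9:
  fixes scale :: "'f::field \<Rightarrow> 'v::ab_group_add \<Rightarrow> 'v"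
    and n :: nat
    and bracket :: "'v list \<Rightarrow> 'v"
    and es :: "'v list"
  assumes "n \<ge> 4" and "even n"
    and "n_lie_algebra scale n bracket"
    and "vector_space.dim scale (UNIV :: 'v set) = n + 1"
    and "\<not> n_lie_algebra.simple scale n bracket"
    and "n_lie_algebra.ordered_basis scale es"
  shows "inj (n_lie_algebra.env_map scale n bracket es)"
proof -
  interpret n_lie_algebra scale n bracket by fact
  note es = assms(6)
  have "dim UNIV = card (set es)"
    using es unfolding ordered_basis_def by (metis dim_span dim_eq_card_independent)
  then have len: "length es = n + 1"
    using assms(4) es unfolding ordered_basis_def by (simp add: distinct_card)
  have ob: "independent (set es)" "span (set es) = UNIV" using es unfolding ordered_basis_def by auto
  have coord: "coord es (signed_bracket es k) j = (-1) ^ k * coord es (bracket (omit k es)) j" for k j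
    unfolding signed_bracket_def using ob by (simp add: representation_scale)
  show ?thesis
  proof (cases "\<forall>p\<le>n. \<forall>q\<le>n. coord es (signed_bracket es p) q = coord es (signed_bracket es q) p")
    case True
    then show ?thesis
      using assms(1,2) by (intro inj_env_map_if_symmetric[OF es len]) (auto simp: coord)
  next
    case False
    then show ?thesis
      using assms(1) inj_env_map_if_nonsymmetric[OF es len] by auto
  qed
qed

end
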